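(* Let $M\subset(N^3,g)$ be a flat $G_X$-invariant surface, locally parametrized by $\psi(u,v)=\phi_v(\gamma(u))$ with $\gamma$ a horizontal lift of the profile curve. Let $\omega(u)=\|X(\gamma(u))\|_g$ and let $a\in\mathbb{R}$ be the constant value of $\omega_u$. Then a loxodrome on $M$ which is not an orbit, and which makes the constant angle $\vartheta_0\in(0,\pi)$ with $X$, can be locally parametrized by $\psi(u,v(u))$ with, for some choice of sign and some $b\in\mathbb{R}$, $$v(u)=\pm\frac{\cot\vartheta_0}{a}\,\ln\omega(u)+b\quad\text{if }a\neq0,\qquad v(u)=\pm\frac{\cot\vartheta_0}{c}\,u+b\quad\text{if }a=0,$$ where in the case $a=0$, $c$ is the constant value of $\omega$.
   Context: $(N^3,g)$ is a three-dimensional Riemannian manifold, $X$ a Killing vector field on $N$, $G_X$ the one-parameter group of isometries generated by $X$, and $\phi_v$ the local flow of $X$. $N_r\subset N$ is the regular part (the set of points belonging to principal orbits of $G_X$; in particular $X\neq 0$ there). The quotient $N_r/G_X$ carries the quotient metric $\tilde g$ making $\pi:N_r\to N_r/G_X$ a Riemannian submersion. A $G_X$-invariant surface is the image in $N_r$ of an immersion $f:M\to N$ for which there is an action of $G_X$ on $M$ with $f(xp)=xf(p)$ for all $x\in G_X$, $p\in M$; $M$ carries the induced metric, and flat means that the Gauss curvature of this metric is zero. Locally it is parametrized by $\psi(u,v)=\phi_v(\gamma(u))$, where $\tilde\gamma:I\to (N_r/G_X,\tilde g)$ ($I$ an open interval) is a curve parametrized by arc length (the profile curve) and $\gamma:I\to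 N$ is a lift of it. The lift is horizontal if $\gamma'$ is orthogonal to $X$; then the induced metric is $du^2+\omega(u)^2dv^2$, and zero curvature means $\omega_{uu}=0$. Subscripts $u$ denote derivatives. A loxodrome on $M$ is a curve on $M$ making a constant angle $\vartheta_0\in[0,\pi)$ with $X$: parametrized by arc length, $g(\alpha',X)=\omega\cos\vartheta_0$. A loxodrome that is not an orbit has $\vartheta_0\ne0$. *)

theory Defs
  imports "HOL-Analysis.Analysis"
begin

fun higher_diff_on :: "nat \<Rightarrow> 'a::real_normed_vector set \<Rightarrow> ('a \<Rightarrow> 'b::real_normed_vector) \<Rightarrow> bool"
  where
    "higher_diff_on 0 S f \<longleftrightarrow> continuous_on S f"
  | "higher_diff_on (Suc n) S f \<longleftrightarrow>
       (\<forall>x\<in>S. f differentiable (at x)) \<and>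
       (\<forall>v. higher_diff_on n S (\<lambda>x. frechet_derivative f (at x) v))"

text \<open>Only meant for open \<open>S\<close>: derivatives are taken at the points of \<open>S\<close> in the full space.\<close>

definition smooth_on :: "'a::real_normed_vector set \<Rightarrow> ('a \<Rightarrow> 'b::real_normed_vector) \<Rightarrow> bool"
  where "smooth_on S f \<longleftrightarrow> (\<forall>n. higher_diff_on n S f)"

text \<open>A manifold is a whole type (Hausdorff and second countable by type class) together with a
  maximal smooth atlas. A chart is a pair \<open>(U, x)\<close>; the values of \<open>x\<close> outside \<open>U\<close> are irrelevant.\<close>

type_synonym ('a, 'n) chart = "'a set \<times> ('a \<Rightarrow> real ^ 'n)"

abbreviation dom_of :: "('a, 'n) chart \<Rightarrow> 'a set" where "dom_of c \<equiv> fst c"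
abbreviation coords :: "('a, 'n) chart \<Rightarrow> 'a \<Rightarrow> real ^ 'n" where "coords c \<equiv> snd c"

definition img_of :: "('a, 'n) chart \<Rightarrow> (real ^ 'n) set"
  where "img_of c = coords c ` dom_of c"

definition chart_inv :: "('a, 'n) chart \<Rightarrow> real ^ 'n \<Rightarrow> 'a"
  where "chart_inv c = inv_into (dom_of c) (coords c)"

definition is_chart :: "('a::topological_space, 'n::finite) chart \<Rightarrow> bool"
  where "is_chart c \<longleftrightarrow> open (dom_of c) \<and> open (img_of c) \<and>
           homeomorphism (dom_of c) (img_of c) (coords c) (chart_inv c)"

definition compatible :: "('a, 'n::finite) chart \<Rightarrow> ('a, 'n) chart \<Rightarrow> bool"
  where "compatible c d \<longleftrightarrow>
           smooth_on (coords c ` (dom_of c \<inter> dom_of d)) (coords d \<circ> chart_inv c) \<and>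
           smooth_on (coords d ` (dom_of c \<inter> dom_of d)) (coords c \<circ> chart_inv d)"

definition smooth_manifold ::
    "('a::{t2_space, second_countable_topology}, 'n::finite) chart set \<Rightarrow> bool"
  where "smooth_manifold A \<longleftrightarrow>
           (\<forall>c\<in>A. is_chart c) \<and> (\<Union>c\<in>A. dom_of c) = UNIV \<and>
           (\<forall>c\<in>A. \<forall>d\<in>A. compatible c d) \<and>
           (\<forall>c. is_chart c \<and> (\<forall>d\<in>A. compatible c d) \<longrightarrow> c \<in> A)"

definition charts_at :: "('a, 'n) chart set \<Rightarrow> 'a \<Rightarrow> ('a, 'n) chart set"
  where "charts_at A p = {c \<in> A. p \<in> dom_of c}"

text \<open>A tangent vector at \<open>p\<close> is the family of its components in all charts around \<open>p\<close>, subject to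
  the transformation law; for all other charts the entry is \<open>0\<close>.\<close>

type_synonym ('a, 'n) tvec = "('a, 'n) chart \<Rightarrow> real ^ 'n"

definition tangent_space :: "('a, 'n::finite) chart set \<Rightarrow> 'a \<Rightarrow> ('a, 'n) tvec set"
  where "tangent_space A p =
           {\<xi>. (\<forall>c. c \<notin> charts_at A p \<longrightarrow> \<xi> c = 0) \<and>
               (\<forall>c\<in>charts_at A p. \<forall>d\<in>charts_at A p.
                  \<xi> d = frechet_derivative (coords d \<circ> chart_inv c) (at (coords c p)) (\<xi> c))}"

text \<open>The tangent vector at \<open>p\<close> whose components in the chart \<open>c\<close> are \<open>v\<close>.\<close>

definition coord_vec ::
    "('a, 'n::finite) chart set \<Rightarrow> ('a, 'n) chart \<Rightarrow> 'a \<Rightarrow> real ^ 'n \<Rightarrow> ('a, 'n) tvec"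
  where "coord_vec A c p v =
           (\<lambda>d. if d \<in> charts_at A p
                then frechet_derivative (coords d \<circ> chart_inv c) (at (coords c p)) v else 0)"

definition smooth_map_on ::
    "('a::topological_space, 'n::finite) chart set \<Rightarrow> ('b::topological_space, 'm::finite) chart set
      \<Rightarrow> 'a set \<Rightarrow> ('a \<Rightarrow> 'b) \<Rightarrow> bool"
  where "smooth_map_on A B W F \<longleftrightarrow> open W \<and> continuous_on W F \<and>
           (\<forall>c\<in>A. \<forall>d\<in>B. smooth_on (coords c ` (dom_of c \<inter> W \<inter> F -` dom_of d))
                                  (coords d \<circ> F \<circ> chart_inv c))"

text \<open>Smoothness of \<open>(t, p) \<mapsto> F t p\<close> as a map from the product of the real line with a manifold.\<close>

definition smooth_family ::
    "('a::topological_space, 'n::finite) chart set \<Rightarrow> ('b::topological_space, 'm::finite) chart set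
      \<Rightarrow> (real \<Rightarrow> 'a \<Rightarrow> 'b) \<Rightarrow> bool"
  where "smooth_family A B F \<longleftrightarrow> continuous_on UNIV (\<lambda>(t, p). F t p) \<and>
           (\<forall>c\<in>A. \<forall>d\<in>B.
              smooth_on {(t, y). y \<in> img_of c \<and> F t (chart_inv c y) \<in> dom_of d}
                        (\<lambda>(t, y). coords d (F t (chart_inv c y))))"

definition differential ::
    "('a, 'n::finite) chart set \<Rightarrow> ('b, 'm::finite) chart set \<Rightarrow> ('a \<Rightarrow> 'b) \<Rightarrow> 'a
      \<Rightarrow> ('a, 'n) tvec \<Rightarrow> ('b, 'm) tvec"
  where "differential A B F p \<xi> =
           (let c = (SOME c. c \<in> charts_at A p) in
            (\<lambda>d. if d \<in> charts_at B (F p)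
                 then frechet_derivative (coords d \<circ> F \<circ> chart_inv c) (at (coords c p)) (\<xi> c)
                 else 0))"

definition open_interval :: "real set \<Rightarrow> bool"
  where "open_interval I \<longleftrightarrow> open I \<and> is_interval I \<and> I \<noteq> {}"

definition smooth_curve :: "('a::topological_space, 'n::finite) chart set \<Rightarrow> real set \<Rightarrow> (real \<Rightarrow> 'a) \<Rightarrow> bool"
  where "smooth_curve A I \<alpha> \<longleftrightarrow> open_interval I \<and> continuous_on I \<alpha> \<and>
           (\<forall>c\<in>A. smooth_on (I \<inter> \<alpha> -` dom_of c) (coords c \<circ> \<alpha>))"

definition velocity :: "('a, 'n::finite) chart set \<Rightarrow> (real \<Rightarrow> 'a) \<Rightarrow> real \<Rightarrow> ('a, 'n) tvec"
  where "velocity A \<alpha> t =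
           (\<lambda>c. if c \<in> charts_at A (\<alpha> t) then vector_derivative (coords c \<circ> \<alpha>) (at t) else 0)"

type_synonym ('a, 'n) metric = "'a \<Rightarrow> ('a, 'n) tvec \<Rightarrow> ('a, 'n) tvec \<Rightarrow> real"

text \<open>\<open>metric_in A g c y v w\<close> is \<open>g\<^sub>i\<^sub>j(y) v\<^sup>i w\<^sup>j\<close> in the chart \<open>c\<close>.\<close>

definition metric_in ::
    "('a, 'n::finite) chart set \<Rightarrow> ('a, 'n) metric \<Rightarrow> ('a, 'n) chart
      \<Rightarrow> real ^ 'n \<Rightarrow> real ^ 'n \<Rightarrow> real ^ 'n \<Rightarrow> real"
  where "metric_in A g c y v w =
           g (chart_inv c y) (coord_vec A c (chart_inv c y) v) (coord_vec A c (chart_inv c y) w)"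

definition riemannian_metric :: "('a, 'n::finite) chart set \<Rightarrow> ('a, 'n) metric \<Rightarrow> bool"
  where "riemannian_metric A g \<longleftrightarrow>
           (\<forall>p. \<forall>\<xi>\<in>tangent_space A p. \<forall>\<eta>\<in>tangent_space A p. g p \<xi> \<eta> = g p \<eta> \<xi>) \<and>
           (\<forall>p. \<forall>\<xi>\<in>tangent_space A p. \<forall>\<eta>\<in>tangent_space A p. \<forall>\<zeta>\<in>tangent_space A p. \<forall>r.
              g p (\<lambda>c. r *\<^sub>R \<xi> c + \<eta> c) \<zeta> = r * g p \<xi> \<zeta> + g p \<eta> \<zeta>) \<and>
           (\<forall>p. \<forall>\<xi>\<in>tangent_space A p. \<xi> \<noteq> (\<lambda>_. 0) \<longrightarrow> g p \<xi> \<xi> > 0) \<and>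
           (\<forall>c\<in>A. \<forall>v w. smooth_on (img_of c) (\<lambda>y. metric_in A g c y v w))"

definition riemannian_manifold ::
    "('a::{t2_space, second_countable_topology}, 'n::finite) chart set \<Rightarrow> ('a, 'n) metric \<Rightarrow> bool"
  where "riemannian_manifold A g \<longleftrightarrow> smooth_manifold A \<and> riemannian_metric A g"

definition tnorm :: "('a, 'n) metric \<Rightarrow> 'a \<Rightarrow> ('a, 'n) tvec \<Rightarrow> real"
  where "tnorm g p \<xi> = sqrt (g p \<xi> \<xi>)"

definition arc_length_param ::
    "('a, 'n::finite) chart set \<Rightarrow> ('a, 'n) metric \<Rightarrow> real set \<Rightarrow> (real \<Rightarrow> 'a) \<Rightarrow> bool"
  where "arc_length_param A g I \<alpha> \<longleftrightarrow> (\<forall>t\<in>I. tnorm g (\<alpha> t) (velocity A \<alpha> t) = 1)"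

definition immersion ::
    "('a::topological_space, 'n::finite) chart set \<Rightarrow> ('b::topological_space, 'm::finite) chart set
      \<Rightarrow> ('a \<Rightarrow> 'b) \<Rightarrow> bool"
  where "immersion A B F \<longleftrightarrow> smooth_map_on A B UNIV F \<and>
           (\<forall>p. inj_on (differential A B F p) (tangent_space A p))"

definition induced_metric ::
    "('a, 'n::finite) chart set \<Rightarrow> ('b, 'm::finite) chart set \<Rightarrow> ('b, 'm) metric \<Rightarrow> ('a \<Rightarrow> 'b)
      \<Rightarrow> ('a, 'n) metric"
  where "induced_metric A B g F =
           (\<lambda>p \<xi> \<eta>. g (F p) (differential A B F p \<xi>) (differential A B F p \<eta>))"

definition riemannian_submersion_on ::
    "('a::topological_space, 'n::finite) chart set \<Rightarrow> ('a, 'n) metric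
      \<Rightarrow> ('b::topological_space, 'm::finite) chart set \<Rightarrow> ('b, 'm) metric
      \<Rightarrow> 'a set \<Rightarrow> ('a \<Rightarrow> 'b) \<Rightarrow> bool"
  where "riemannian_submersion_on A g B h W \<pi> \<longleftrightarrow> smooth_map_on A B W \<pi> \<and>
           (\<forall>p\<in>W.
              differential A B \<pi> p ` tangent_space A p = tangent_space B (\<pi> p) \<and>
              (let V = {\<zeta> \<in> tangent_space A p. differential A B \<pi> p \<zeta> = (\<lambda>_. 0)};
                   H = {\<xi> \<in> tangent_space A p. \<forall>\<zeta>\<in>V. g p \<xi> \<zeta> = 0}
               in \<forall>\<xi>\<in>H. \<forall>\<eta>\<in>H.
                    h (\<pi> p) (differential A B \<pi> p \<xi>) (differential A B \<pi> p \<eta>) = g p \<xi> \<eta>))"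

definition partial_deriv :: "'n::finite \<Rightarrow> (real ^ 'n \<Rightarrow> real) \<Rightarrow> real ^ 'n \<Rightarrow> real"
  where "partial_deriv i F y = frechet_derivative F (at y) (axis i 1)"

text \<open>In the next three definitions \<open>h\<close> is the matrix \<open>(h\<^sub>i\<^sub>j)\<close> of a metric in coordinates.
  \<open>christoffel h k i j\<close> is \<open>\<Gamma>\<^sup>k\<^sub>i\<^sub>j\<close>, and \<open>riemann h l i j k\<close> is the \<open>l\<close>-th component of
  \<open>R(\<partial>\<^sub>i, \<partial>\<^sub>j) \<partial>\<^sub>k\<close>, where \<open>R(X, Y) = \<nabla>\<^sub>X \<nabla>\<^sub>Y - \<nabla>\<^sub>Y \<nabla>\<^sub>X - \<nabla>\<^bsub>[X,Y]\<^esub>\<close>.\<close>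

definition christoffel ::
    "(real ^ 'n \<Rightarrow> real ^ 'n ^ 'n::finite) \<Rightarrow> 'n \<Rightarrow> 'n \<Rightarrow> 'n \<Rightarrow> real ^ 'n \<Rightarrow> real"
  where "christoffel h k i j y =
           (\<Sum>l\<in>UNIV. matrix_inv (h y) $ k $ l *
              (partial_deriv i (\<lambda>z. h z $ j $ l) y + partial_deriv j (\<lambda>z. h z $ i $ l) y
               - partial_deriv l (\<lambda>z. h z $ i $ j) y)) / 2"

definition riemann ::
    "(real ^ 'n \<Rightarrow> real ^ 'n ^ 'n::finite) \<Rightarrow> 'n \<Rightarrow> 'n \<Rightarrow> 'n \<Rightarrow> 'n \<Rightarrow> real ^ 'n \<Rightarrow> real"
  where "riemann h l i j k y =
           partial_deriv i (christoffel h l j k) y - partial_deriv j (christoffel h l i k) y +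
           (\<Sum>m\<in>UNIV. christoffel h l i m y * christoffel h m j k y
                    - christoffel h l j m y * christoffel h m i k y)"

definition gauss_curvature_in :: "(real ^ 2 \<Rightarrow> real ^ 2 ^ 2) \<Rightarrow> real ^ 2 \<Rightarrow> real"
  where "gauss_curvature_in h y = (\<Sum>l\<in>UNIV. riemann h l 1 2 2 y * h y $ l $ 1) / det (h y)"

text \<open>The Gauss curvature does not depend on the chart in which it is computed, so that flatness
  may be required in all of them.\<close>

definition flat :: "('a, 2) chart set \<Rightarrow> ('a, 2) metric \<Rightarrow> bool"
  where "flat A g \<longleftrightarrow>
           (\<forall>c\<in>A. \<forall>y\<in>img_of c.
              gauss_curvature_in (\<lambda>z. \<chi> i j. metric_in A g c z (axis i 1) (axis j 1)) y = 0)"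

definition smooth_vector_field :: "('a, 'n::finite) chart set \<Rightarrow> ('a \<Rightarrow> ('a, 'n) tvec) \<Rightarrow> bool"
  where "smooth_vector_field A X \<longleftrightarrow>
           (\<forall>p. X p \<in> tangent_space A p) \<and>
           (\<forall>c\<in>A. smooth_on (img_of c) (\<lambda>y. X (chart_inv c y) c))"

text \<open>The Lie derivative of \<open>g\<close> along \<open>X\<close> vanishes.\<close>

definition killing_field ::
    "('a, 'n::finite) chart set \<Rightarrow> ('a, 'n) metric \<Rightarrow> ('a \<Rightarrow> ('a, 'n) tvec) \<Rightarrow> bool"
  where "killing_field A g X \<longleftrightarrow> smooth_vector_field A X \<and>
           (\<forall>c\<in>A. \<forall>y\<in>img_of c. \<forall>v w.
              (let Y = (\<lambda>z. X (chart_inv c z) c); G = metric_in A g c in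
               frechet_derivative (\<lambda>z. G z v w) (at y) (Y y)
               + G y (frechet_derivative Y (at y) v) w
               + G y v (frechet_derivative Y (at y) w) = 0))"

definition flow_of ::
    "('a::topological_space, 'n::finite) chart set \<Rightarrow> ('a \<Rightarrow> ('a, 'n) tvec) \<Rightarrow> (real \<Rightarrow> 'a \<Rightarrow> 'a) \<Rightarrow> bool"
  where "flow_of A X \<phi> \<longleftrightarrow> smooth_family A A \<phi> \<and> \<phi> 0 = id \<and> (\<forall>s t. \<phi> (s + t) = \<phi> s \<circ> \<phi> t) \<and>
           (\<forall>t p. velocity A (\<lambda>s. \<phi> s p) t = X (\<phi> t p))"

text \<open>The group generated by the field with flow \<open>\<phi>\<close> is \<open>range \<phi>\<close>.\<close>

definition orbit :: "(real \<Rightarrow> 'a \<Rightarrow> 'a) \<Rightarrow> 'a \<Rightarrow> 'a set"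
  where "orbit \<phi> p = {x p | x. x \<in> range \<phi>}"

definition stabilizer :: "(real \<Rightarrow> 'a \<Rightarrow> 'a) \<Rightarrow> 'a \<Rightarrow> ('a \<Rightarrow> 'a) set"
  where "stabilizer \<phi> p = {x \<in> range \<phi>. x p = p}"

text \<open>An orbit is principal if its isotropy groups are, up to conjugation, contained in all isotropy
  groups; the stabilizers of the points \<open>x q\<close> are the conjugates of that of \<open>q\<close>.\<close>

definition regular_part :: "(real \<Rightarrow> 'a \<Rightarrow> 'a) \<Rightarrow> 'a set"
  where "regular_part \<phi> = {p. \<forall>q. \<exists>x\<in>range \<phi>. stabilizer \<phi> p \<subseteq> stabilizer \<phi> (x q)}"

text \<open>\<open>(Q, h, \<pi>)\<close> is a model of the quotient of the regular part by the group, with its quotient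
  metric.\<close>

definition quotient_model ::
    "('a::topological_space, 'n::finite) chart set \<Rightarrow> ('a, 'n) metric \<Rightarrow> (real \<Rightarrow> 'a \<Rightarrow> 'a)
      \<Rightarrow> ('q::{t2_space, second_countable_topology}, 'm::finite) chart set \<Rightarrow> ('q, 'm) metric
      \<Rightarrow> ('a \<Rightarrow> 'q) \<Rightarrow> bool"
  where "quotient_model A g \<phi> Q h \<pi> \<longleftrightarrow>
           riemannian_manifold Q h \<and>
           \<pi> ` regular_part \<phi> = UNIV \<and>
           (\<forall>p\<in>regular_part \<phi>. \<forall>q\<in>regular_part \<phi>. \<pi> p = \<pi> q \<longleftrightarrow> q \<in> orbit \<phi> p) \<and>
           riemannian_submersion_on A g Q h (regular_part \<phi>) \<pi>"

definition horizontal_lift ::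
    "('a::topological_space, 'n::finite) chart set \<Rightarrow> ('a, 'n) metric \<Rightarrow> ('a \<Rightarrow> ('a, 'n) tvec)
      \<Rightarrow> (real \<Rightarrow> 'a \<Rightarrow> 'a) \<Rightarrow> ('a \<Rightarrow> 'q) \<Rightarrow> real set \<Rightarrow> (real \<Rightarrow> 'q) \<Rightarrow> (real \<Rightarrow> 'a) \<Rightarrow> bool"
  where "horizontal_lift A g X \<phi> \<pi> I \<gamma>Q \<gamma> \<longleftrightarrow> smooth_curve A I \<gamma> \<and>
           (\<forall>u\<in>I. \<gamma> u \<in> regular_part \<phi> \<and> \<pi> (\<gamma> u) = \<gamma>Q u \<and>
                   g (\<gamma> u) (velocity A \<gamma> u) (X (\<gamma> u)) = 0)"

definition group_action ::
    "(real \<Rightarrow> 'a \<Rightarrow> 'a) \<Rightarrow> ('b::topological_space, 'm::finite) chart set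
      \<Rightarrow> (('a \<Rightarrow> 'a) \<Rightarrow> 'b \<Rightarrow> 'b) \<Rightarrow> bool"
  where "group_action \<phi> M act \<longleftrightarrow>
           act id = id \<and> (\<forall>x\<in>range \<phi>. \<forall>y\<in>range \<phi>. act (x \<circ> y) = act x \<circ> act y) \<and>
           smooth_family M M (\<lambda>t. act (\<phi> t))"

definition invariant_surface ::
    "('a::topological_space, 3) chart set \<Rightarrow> (real \<Rightarrow> 'a \<Rightarrow> 'a)
      \<Rightarrow> ('b::{t2_space, second_countable_topology}, 2) chart set \<Rightarrow> ('b \<Rightarrow> 'a) \<Rightarrow> bool"
  where "invariant_surface A \<phi> M f \<longleftrightarrow> smooth_manifold M \<and> immersion M A f \<and>
           range f \<subseteq> regular_part \<phi> \<and>
           (\<exists>act. group_action \<phi> M act \<and> (\<forall>x\<in>range \<phi>. \<forall>p. f (act x p) = x (f p)))"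

text \<open>The chart \<open>\<kappa>\<close> is the inverse of the local parametrization \<open>\<psi>\<close> of the surface: in its
  coordinates, the immersion \<open>f\<close> is \<open>\<psi>(u, v) = \<phi>\<^sub>v(\<gamma>(u))\<close> on the rectangle \<open>I \<times> J\<close>.\<close>

definition local_parametrization ::
    "('b, 2) chart set \<Rightarrow> ('b \<Rightarrow> 'a) \<Rightarrow> (real \<Rightarrow> 'a \<Rightarrow> 'a) \<Rightarrow> real set \<Rightarrow> (real \<Rightarrow> 'a) \<Rightarrow> real set
      \<Rightarrow> ('b, 2) chart \<Rightarrow> bool"
  where "local_parametrization M f \<phi> I \<gamma> J \<kappa> \<longleftrightarrow> open_interval I \<and> open_interval J \<and> \<kappa> \<in> M \<and>
           img_of \<kappa> = {y. y $ 1 \<in> I \<and> y $ 2 \<in> J} \<and>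
           (\<forall>u\<in>I. \<forall>v\<in>J. f (chart_inv \<kappa> (vector [u, v])) = \<phi> v (\<gamma> u))"

definition loxodrome ::
    "('a::topological_space, 3) chart set \<Rightarrow> ('a, 3) metric \<Rightarrow> ('a \<Rightarrow> ('a, 3) tvec)
      \<Rightarrow> ('b::topological_space, 2) chart set \<Rightarrow> ('b \<Rightarrow> 'a) \<Rightarrow> real \<Rightarrow> real set \<Rightarrow> (real \<Rightarrow> 'b) \<Rightarrow> bool"
  where "loxodrome A g X M f \<theta> K \<alpha> \<longleftrightarrow> 0 \<le> \<theta> \<and> \<theta> < pi \<and> smooth_curve M K \<alpha> \<and>
           arc_length_param M (induced_metric M A g f) K \<alpha> \<and>
           (\<forall>s\<in>K. g (f (\<alpha> s)) (differential M A f (\<alpha> s) (velocity M \<alpha> s)) (X (f (\<alpha> s)))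
                  = tnorm g (f (\<alpha> s)) (X (f (\<alpha> s))) * cos \<theta>)"

text \<open>Near \<open>s\<^sub>0\<close> the curve \<open>\<alpha>\<close> is a regular reparametrization of \<open>u \<mapsto> (u, v(u))\<close> in the
  coordinates \<open>\<kappa>\<close>.\<close>

definition locally_graph ::
    "('b, 2) chart \<Rightarrow> real set \<Rightarrow> (real \<Rightarrow> 'b) \<Rightarrow> real \<Rightarrow> (real \<Rightarrow> real) \<Rightarrow> bool"
  where "locally_graph \<kappa> K \<alpha> s\<^sub>0 v \<longleftrightarrow>
           (\<exists>K\<^sub>0 r. open_interval K\<^sub>0 \<and> s\<^sub>0 \<in> K\<^sub>0 \<and> K\<^sub>0 \<subseteq> K \<and>
              smooth_on K\<^sub>0 r \<and> inj_on r K\<^sub>0 \<and> (\<forall>s\<in>K\<^sub>0. deriv r s \<noteq> 0) \<and>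
              (\<forall>s\<in>K\<^sub>0. vector [r s, v (r s)] \<in> img_of \<kappa> \<and>
                        \<alpha> s = chart_inv \<kappa> (vector [r s, v (r s)])))"

end

theory Submission
  imports Defs
begin

text \<open>
  For \<open>F(u, v) = \<phi>\<^sub>v(\<gamma>(u))\<close> both \<open>F\<^sub>u\<close> and \<open>F\<^sub>v = X\<close> are transported by the flow, so by the Killing
  equation their inner products do not depend on \<open>v\<close> and can be read off at \<open>v = 0\<close>: there \<open>F\<^sub>u = \<gamma>'\<close> is
  orthogonal to \<open>X\<close>, and it has unit length because the submersion maps it isometrically to the velocity of
  the profile curve. Hence the induced metric is \<open>du\<^sup>2 + \<omega>(u)\<^sup>2 dv\<^sup>2\<close>, with \<open>\<omega> > 0\<close> because an
  immersion cannot kill the direction mapped to \<open>X\<close>. Its Gauss curvature is \<open>-\<omega>''/\<omega>\<close>, so \<open>\<omega>'\<close> is constant.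
  A unit speed curve \<open>(u(s), v(s))\<close> at angle \<open>\<theta>\<close> with \<open>X\<close> satisfies \<open>\<omega> v' = cos \<theta>\<close> and \<open>u'\<^sup>2 = sin\<^sup>2 \<theta>\<close>; so \<open>u'\<close>
  has constant sign and \<open>dv/du = \<plusminus>cot \<theta> / \<omega>(u)\<close>, which integrates to the two formulas.
\<close>

subsection \<open>Smooth maps between normed spaces\<close>

text \<open>Transport by the flow is encoded infinitesimally: in every chart a transported field
  \<eta> solves the linear equation \<eta>' = DX(\<eta>). For \<open>X\<close> this is the chain
  rule; for F_u it is the symmetry of mixed partials, d/dv F_u = d/du X(F) = DX(F_u). For two such
  fields the product rule for g(\<eta>, \<zeta>) along an orbit produces the left side of the
  Killing equation, which gives the invariance. The obstacle is the form of the data: smoothness is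
  iterated differentiability in fixed directions, and tangent vectors are families of chart
  components. This calls for a calculus closed under composition, and every geometric step ends in a
  chart. The computation uses E = \<omega>^2 = g(X, X), a polynomial in smooth chart components; its
  square root is differentiated only once E > 0 is known. The sign in the final formula is that of
  u', the direction in which the curve crosses the orbits. Since sin \<theta> is not 0, u is
  strictly monotone in s and can serve as the parameter; this is where the loxodrome must not be an
  orbit.\<close>

lemma higher_diff_on_cong:
  assumes "open S" "\<And>x. x \<in> S \<Longrightarrow> f x = k x"
  shows "higher_diff_on n S f \<longleftrightarrow> higher_diff_on n S k"
  using assms(2)
proof (induction n arbitrary: f k)
  case 0
  then show ?case by (simp cong: continuous_on_cong)
next
  case (Suc n)
  have 1: "(f has_derivative D) (at x) \<longleftrightarrow> (k has_derivative D) (at x)" if "x \<in> S" for x D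
    using that Suc.prems assms(1) has_derivative_transform_within_open by (metis (no_types, lifting))
  have 2: "frechet_derivative f (at x) = frechet_derivative k (at x)" if "x \<in> S" for x
    unfolding frechet_derivative_def using 1[OF that] by simp
  have "higher_diff_on n S (\<lambda>x. frechet_derivative f (at x) v)
      \<longleftrightarrow> higher_diff_on n S (\<lambda>x. frechet_derivative k (at x) v)" for v
    by (rule Suc.IH) (simp add: 2)
  then show ?case using 1 unfolding higher_diff_on.simps differentiable_def by blast
qed

lemma higher_diff_on_SucD: "higher_diff_on (Suc n) S f \<Longrightarrow> higher_diff_on n S f"
proof (induction n arbitrary: f)
  case 0
  then show ?case
    by (auto intro!: continuous_at_imp_continuous_on differentiable_imp_continuous_within)
next
  case (Suc n)
  then show ?case using higher_diff_on.simps(2) by blast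
qed

lemma higher_diff_on_subset: "higher_diff_on n S f \<Longrightarrow> T \<subseteq> S \<Longrightarrow> higher_diff_on n T f"
  by (induction n arbitrary: f) (auto intro: continuous_on_subset)

text \<open>An explicit candidate \<open>D\<close> replaces the choice made by
  \<open>frechet_derivative\<close>; on an open set the two agree at every point, so their
  smoothness is the same. All closure properties are proved through this rule.\<close>

lemma higher_diff_on_SucI:
  assumes "open S" "\<And>x. x \<in> S \<Longrightarrow> (f has_derivative D x) (at x)"
    "\<And>v. higher_diff_on n S (\<lambda>x. D x v)"
  shows "higher_diff_on (Suc n) S f"
proof -
  have "frechet_derivative f (at x) = D x" if "x \<in> S" for x
    using assms(2)[OF that] frechet_derivative_at by metis
  then have "higher_diff_on n S (\<lambda>x. frechet_derivative f (at x) v)" for v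
    using assms(3)[of v]
      higher_diff_on_cong[OF assms(1), of "\<lambda>x. frechet_derivative f (at x) v" "\<lambda>x. D x v" n]
    by simp
  then show ?thesis using assms(2) unfolding higher_diff_on.simps differentiable_def by blast
qed

lemma higher_diff_on_SucE:
  assumes "higher_diff_on (Suc n) S f"
  shows "\<And>x. x \<in> S \<Longrightarrow> (f has_derivative frechet_derivative f (at x)) (at x)"
    and "\<And>v. higher_diff_on n S (\<lambda>x. frechet_derivative f (at x) v)"
  using assms frechet_derivative_works by auto

lemma higher_diff_on_const: "open S \<Longrightarrow> higher_diff_on n S (\<lambda>_. c)"
proof (induction n arbitrary: c)
  case (Suc n)
  then show ?case by (intro higher_diff_on_SucI[where D="\<lambda>_ _. 0"]) auto
qed auto

lemma higher_diff_on_bounded_linear: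
  assumes "open S" "bounded_linear L" "higher_diff_on n S f"
  shows "higher_diff_on n S (\<lambda>x. L (f x))"
  using assms(3)
proof (induction n arbitrary: f)
  case 0
  then show ?case using assms(2)
    by (auto intro: bounded_linear.continuous_on)
next
  case (Suc n)
  show ?case
    by (rule higher_diff_on_SucI[OF assms(1), where D="\<lambda>x v. L (frechet_derivative f (at x) v)"])
       (auto intro!: bounded_linear.has_derivative[OF assms(2)] Suc.IH higher_diff_on_SucE[OF Suc.prems])
qed

lemma higher_diff_on_linear:
  "open S \<Longrightarrow> bounded_linear L \<Longrightarrow> higher_diff_on n S L"
proof (cases n)
  case 0
  assume "bounded_linear L"
  then show ?thesis using 0 by (auto intro: bounded_linear.continuous_on)
next
  case (Suc m)
  assume "open S" "bounded_linear L"
  then show ?thesis unfolding Suc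
    by (intro higher_diff_on_SucI[where D="\<lambda>_. L"] higher_diff_on_const bounded_linear_imp_has_derivative)
qed

lemma higher_diff_on_add:
  assumes "open S" "higher_diff_on n S f" "higher_diff_on n S k"
  shows "higher_diff_on n S (\<lambda>x. f x + k x)"
  using assms(2,3)
proof (induction n arbitrary: f k)
  case (Suc n)
  show ?case
    by (rule higher_diff_on_SucI[OF assms(1), where
          D="\<lambda>x v. frechet_derivative f (at x) v + frechet_derivative k (at x) v"])
       (intro has_derivative_add Suc.IH higher_diff_on_SucE[OF Suc.prems(1)]
          higher_diff_on_SucE[OF Suc.prems(2)]; assumption)+
qed (auto intro: continuous_intros)

lemma higher_diff_on_sum:
  assumes "open S" "\<And>i. i \<in> B \<Longrightarrow> higher_diff_on n S (f i)"
  shows "higher_diff_on n S (\<lambda>x. \<Sum>i\<in>B. f i x)"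
  using assms(2)
  by (induction B rule: infinite_finite_induct)
     (auto intro!: higher_diff_on_const higher_diff_on_add assms(1))

text \<open>The product rule puts \<open>f\<close> and \<open>k\<close> themselves next to their
  derivatives, so the induction also uses that order \<open>Suc n\<close> implies order
  \<open>n\<close>.\<close>

lemma higher_diff_on_scaleR:
  fixes f :: "'a::real_normed_vector \<Rightarrow> real" and k :: "'a \<Rightarrow> 'b::real_normed_vector"
  assumes "open S" "higher_diff_on n S f" "higher_diff_on n S k"
  shows "higher_diff_on n S (\<lambda>x. f x *\<^sub>R k x)"
  using assms(2,3)
proof (induction n arbitrary: f k)
  case (Suc n)
  show ?case
    by (rule higher_diff_on_SucI[OF assms(1), where
          D="\<lambda>x v. f x *\<^sub>R frechet_derivative k (at x) v + frechet_derivative f (at x) v *\<^sub>R k x"])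
       (intro has_derivative_scaleR higher_diff_on_add[OF assms(1)] Suc.IH
          higher_diff_on_SucE[OF Suc.prems(1)] higher_diff_on_SucE[OF Suc.prems(2)]
          higher_diff_on_SucD[OF Suc.prems(1)] higher_diff_on_SucD[OF Suc.prems(2)]; assumption)+
qed (auto intro: continuous_intros)

text \<open>The chain rule evaluates the derivative of \<open>f\<close> in the direction Dk(x) v,
  which moves with x, while the definition controls fixed directions only. Expanding that direction
  over \<open>Basis\<close> leaves products of scalar functions with derivatives of \<open>f\<close>
  in fixed directions, composed with the same \<open>k\<close>; hence the middle space is Euclidean
  and \<open>k\<close> stays fixed in the induction.\<close>

lemma higher_diff_on_compose:
  fixes f :: "'b::euclidean_space \<Rightarrow> 'c::real_normed_vector"
    and k :: "'a::real_normed_vector \<Rightarrow> 'b"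
  assumes "open S" "k ` S \<subseteq> T" "higher_diff_on n T f" "higher_diff_on n S k"
  shows "higher_diff_on n S (\<lambda>x. f (k x))"
  using assms(3,4)
proof (induction n arbitrary: f)
  case 0
  then show ?case using assms(2) by (auto intro: continuous_on_compose2)
next
  case (Suc n)
  note f = higher_diff_on_SucE[OF Suc.prems(1)] and k = higher_diff_on_SucE[OF Suc.prems(2)]
  show ?case
  proof (rule higher_diff_on_SucI[OF assms(1), where
        D="\<lambda>x v. \<Sum>b\<in>Basis. (frechet_derivative k (at x) v \<bullet> b)
                    *\<^sub>R frechet_derivative f (at (k x)) b"])
    fix x assume x: "x \<in> S"
    then have kx: "k x \<in> T" using assms(2) by auto
    have *: "frechet_derivative f (at (k x)) w
        = (\<Sum>b\<in>Basis. (w \<bullet> b) *\<^sub>R frechet_derivative f (at (k x)) b)" for w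
    proof -
      have l: "linear (frechet_derivative f (at (k x)))"
        using f(1)[OF kx] has_derivative_linear by blast
      have "frechet_derivative f (at (k x)) (\<Sum>b\<in>Basis. (w \<bullet> b) *\<^sub>R b)
        = (\<Sum>b\<in>Basis. (w \<bullet> b) *\<^sub>R frechet_derivative f (at (k x)) b)"
        by (simp only: linear_sum[OF l] linear_cmul[OF l])
      then show ?thesis by (simp add: euclidean_representation)
    qed
    then show "((\<lambda>x. f (k x)) has_derivative (\<lambda>v. \<Sum>b\<in>Basis. (frechet_derivative k (at x) v \<bullet> b)
                    *\<^sub>R frechet_derivative f (at (k x)) b)) (at x)"
      using has_derivative_compose[OF k(1)[OF x] f(1)[OF kx]]
      by (subst (asm) *)
  next
    fix v
    have "higher_diff_on n S (\<lambda>x. frechet_derivative k (at x) v \<bullet> b)" for b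
      by (rule higher_diff_on_bounded_linear[OF assms(1) bounded_linear_inner_left k(2)])
    then show "higher_diff_on n S (\<lambda>x. \<Sum>b\<in>Basis. (frechet_derivative k (at x) v \<bullet> b)
                    *\<^sub>R frechet_derivative f (at (k x)) b)"
      by (intro higher_diff_on_sum higher_diff_on_scaleR Suc.IH assms(1) f(2)
          higher_diff_on_SucD[OF Suc.prems(2)]) auto
  qed
qed

section \<open>Closure properties at infinite order\<close>

lemma smooth_on_cong: "open S \<Longrightarrow> (\<And>x. x \<in> S \<Longrightarrow> f x = k x) \<Longrightarrow> smooth_on S f \<longleftrightarrow> smooth_on S k"
  unfolding smooth_on_def using higher_diff_on_cong by blast

lemma smooth_on_subset: "smooth_on S f \<Longrightarrow> T \<subseteq> S \<Longrightarrow> smooth_on T f"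
  unfolding smooth_on_def using higher_diff_on_subset by blast

lemma smooth_on_linear: "open S \<Longrightarrow> bounded_linear L \<Longrightarrow> smooth_on S L"
  unfolding smooth_on_def using higher_diff_on_linear by blast

lemma smooth_on_bounded_linear:
  "open S \<Longrightarrow> bounded_linear L \<Longrightarrow> smooth_on S f \<Longrightarrow> smooth_on S (\<lambda>x. L (f x))"
  unfolding smooth_on_def using higher_diff_on_bounded_linear by blast

lemma smooth_on_add:
  "open S \<Longrightarrow> smooth_on S f \<Longrightarrow> smooth_on S k \<Longrightarrow> smooth_on S (\<lambda>x. f x + k x)"
  unfolding smooth_on_def using higher_diff_on_add by blast

lemma smooth_on_sum:
  "open S \<Longrightarrow> (\<And>i. i \<in> B \<Longrightarrow> smooth_on S (f i)) \<Longrightarrow> smooth_on S (\<lambda>x. \<Sum>i\<in>B. f i x)"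
  unfolding smooth_on_def by (simp add: higher_diff_on_sum)

lemma smooth_on_scaleR:
  fixes f :: "'a::real_normed_vector \<Rightarrow> real"
  shows "open S \<Longrightarrow> smooth_on S f \<Longrightarrow> smooth_on S k \<Longrightarrow> smooth_on S (\<lambda>x. f x *\<^sub>R k x)"
  unfolding smooth_on_def using higher_diff_on_scaleR by blast

lemma smooth_on_compose:
  fixes f :: "'b::euclidean_space \<Rightarrow> 'c::real_normed_vector"
  shows "open S \<Longrightarrow> k ` S \<subseteq> T \<Longrightarrow> smooth_on T f \<Longrightarrow> smooth_on S k \<Longrightarrow> smooth_on S (\<lambda>x. f (k x))"
  unfolding smooth_on_def using higher_diff_on_compose by blast

lemma smooth_on_differentiable: "smooth_on S f \<Longrightarrow> x \<in> S \<Longrightarrow> f differentiable (at x)"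
  unfolding smooth_on_def using higher_diff_on.simps(2) by blast

lemma smooth_on_has_derivative:
  "smooth_on S f \<Longrightarrow> x \<in> S \<Longrightarrow> (f has_derivative frechet_derivative f (at x)) (at x)"
  using smooth_on_differentiable frechet_derivative_works by blast

lemma smooth_on_frechet_derivative:
  "smooth_on S f \<Longrightarrow> smooth_on S (\<lambda>x. frechet_derivative f (at x) v)"
  unfolding smooth_on_def using higher_diff_on.simps(2) by blast

lemma smooth_on_continuous: "smooth_on S f \<Longrightarrow> continuous_on S f"
  unfolding smooth_on_def using higher_diff_on.simps(1) by blast

section \<open>Partial derivatives in the plane and their symmetry\<close>

lemma has_derivative_line:
  assumes "(F has_derivative D) (at (p + t0 *\<^sub>R e))"
  shows "((\<lambda>t. F (p + t *\<^sub>R e)) has_vector_derivative D e) (at t0)"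
proof -
  have "((\<lambda>t. p + t *\<^sub>R e) has_derivative (\<lambda>h. h *\<^sub>R e)) (at t0)"
    by (auto intro!: derivative_eq_intros)
  from has_derivative_compose[OF this assms]
  have "((\<lambda>t. F (p + t *\<^sub>R e)) has_derivative (\<lambda>h. D (h *\<^sub>R e))) (at t0)" .
  then show ?thesis
    unfolding has_vector_derivative_def
    using linear_cmul[OF has_derivative_linear[OF assms]] by simp
qed

lemma has_vector_derivative_fst:
  assumes "(F has_derivative D) (at (t, u))"
  shows "((\<lambda>t. F (t, u)) has_vector_derivative D (1, 0)) (at t)"
  using has_derivative_line[of F D "(0, u)" t "(1, 0)"] assms by simp

lemma has_vector_derivative_snd:
  assumes "(F has_derivative D) (at (t, u))"
  shows "((\<lambda>u. F (t, u)) has_vector_derivative D (0, 1)) (at u)"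
  using has_derivative_line[of F D "(t, 0)" u "(0, 1)"] assms by simp

text \<open>Differentiate \<open>F(t, u) = F(l, u) + \<integral> F\<^sub>t\<close> in \<open>u\<close> under the integral sign, then in \<open>t\<close>.\<close>

lemma smooth_on_mixed_partials:
  fixes F :: "real \<times> real \<Rightarrow> 'c::euclidean_space"
  assumes U: "open U" and F: "smooth_on U F" and p: "(t0, u0) \<in> U"
  defines "Ft \<equiv> \<lambda>p. frechet_derivative F (at p) (1, 0)"
    and "Fu \<equiv> \<lambda>p. frechet_derivative F (at p) (0, 1)"
  shows "((\<lambda>t. Fu (t, u0)) has_vector_derivative frechet_derivative Ft (at (t0, u0)) (0, 1)) (at t0)"
proof -
  define Ftu where "Ftu = (\<lambda>p. frechet_derivative Ft (at p) (0, 1))"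
  have sFt: "smooth_on U Ft" unfolding Ft_def using F by (rule smooth_on_frechet_derivative)
  have sFtu: "smooth_on U Ftu" unfolding Ftu_def using sFt by (rule smooth_on_frechet_derivative)
  obtain A B where AB: "open A" "open B" "t0 \<in> A" "u0 \<in> B" "A \<times> B \<subseteq> U"
    using open_prod_elim[OF U p] by (metis SigmaD1 SigmaD2)
  obtain d where d: "d > 0" "cball t0 d \<subseteq> A" using AB open_contains_cball by blast
  obtain e where e: "e > 0" "cball u0 e \<subseteq> B" using AB open_contains_cball by blast
  \<comment> \<open>The integrals start strictly to the left of t0, so that t0 is interior to their
    range and the derivative there is two-sided.\<close>
  define l where "l = t0 - d"
  have inU: "(t, u) \<in> U" if "t \<in> {l..t0 + d}" "u \<in> cball u0 e" for t u
  proof -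
    have "t \<in> cball t0 d" using that(1) d(1) by (auto simp: l_def dist_real_def)
    then show ?thesis using that(2) d(2) e(2) AB(5) by blast
  qed
  have cont: "continuous_on {l..t0 + d} (\<lambda>s. Ftu (s, u0))"
    by (rule continuous_on_compose2[OF smooth_on_continuous[OF sFtu]])
       (use e in \<open>auto intro!: continuous_intros inU\<close>)
  have ftc: "integral {l..t} (\<lambda>s. Ft (s, u)) = F (t, u) - F (l, u)"
    if t: "t \<in> {l..t0 + d}" and u: "u \<in> cball u0 e" for t u
  proof (rule integral_unique, rule fundamental_theorem_of_calculus)
    fix s assume "s \<in> {l..t}"
    then have "(s, u) \<in> U" using t u inU by auto
    then have "((\<lambda>s. F (s, u)) has_vector_derivative Ft (s, u)) (at s)"
      unfolding Ft_def using F by (intro has_vector_derivative_fst smooth_on_has_derivative)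
    then show "((\<lambda>s. F (s, u)) has_vector_derivative Ft (s, u)) (at s within {l..t})"
      by (rule has_vector_derivative_at_within)
  qed (use t in auto)
  have eq: "integral {l..t} (\<lambda>s. Ftu (s, u0)) = Fu (t, u0) - Fu (l, u0)"
    if t: "t \<in> {l..t0 + d}" for t
  proof -
    have "((\<lambda>u. integral (cbox l t) (\<lambda>s. Ft (s, u))) has_vector_derivative
        integral (cbox l t) (\<lambda>s. Ftu (s, u0))) (at u0 within cball u0 e)"
    proof (rule leibniz_rule_vector_derivative)
      fix u s assume u: "u \<in> cball u0 e" and s: "s \<in> cbox l t"
      then have "(s, u) \<in> U" using t inU by auto
      then have "((\<lambda>u. Ft (s, u)) has_vector_derivative Ftu (s, u)) (at u)"
        unfolding Ftu_def using sFt by (intro has_vector_derivative_snd smooth_on_has_derivative)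
      then show "((\<lambda>u. Ft (s, u)) has_vector_derivative Ftu (s, u)) (at u within cball u0 e)"
        by (rule has_vector_derivative_at_within)
    next
      fix u assume u: "u \<in> cball u0 e"
      show "(\<lambda>s. Ft (s, u)) integrable_on cbox l t"
        by (intro integrable_continuous
            continuous_on_compose2[OF smooth_on_continuous[OF sFt]])
           (use u t in \<open>auto intro!: continuous_intros inU\<close>)
    next
      show "continuous_on (cball u0 e \<times> cbox l t) (\<lambda>(u, s). Ftu (s, u))"
        unfolding split_beta
        by (intro continuous_on_compose2[OF smooth_on_continuous[OF sFtu]])
           (use t in \<open>auto intro!: continuous_intros inU\<close>)
    qed (use e in auto)
    then have "((\<lambda>u. integral (cbox l t) (\<lambda>s. Ft (s, u))) has_vector_derivative
        integral (cbox l t) (\<lambda>s. Ftu (s, u0))) (at u0)"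
      using e by (subst (asm) at_within_interior) auto
    then have 1: "((\<lambda>u. F (t, u) - F (l, u)) has_vector_derivative
        integral (cbox l t) (\<lambda>s. Ftu (s, u0))) (at u0)"
      by (rule has_vector_derivative_transform_within_open[where S="ball u0 e"])
         (use e t ftc in \<open>auto\<close>)
    have "(t, u0) \<in> U" "(l, u0) \<in> U" using t e d inU by (auto simp: l_def)
    then have "((\<lambda>u. F (t, u) - F (l, u)) has_vector_derivative Fu (t, u0) - Fu (l, u0)) (at u0)"
      unfolding Fu_def using F
      by (intro has_vector_derivative_diff has_vector_derivative_snd smooth_on_has_derivative)
    with 1 show ?thesis using vector_derivative_unique_at by auto
  qed
  have "((\<lambda>t. integral {l..t} (\<lambda>s. Ftu (s, u0))) has_vector_derivative Ftu (t0, u0))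
      (at t0 within {l..t0 + d})"
    by (rule integral_has_vector_derivative[OF cont]) (use d in \<open>auto simp: l_def\<close>)
  then have "((\<lambda>t. integral {l..t} (\<lambda>s. Ftu (s, u0))) has_vector_derivative Ftu (t0, u0)) (at t0)"
    using d by (subst (asm) at_within_interior) (auto simp: l_def)
  then have "((\<lambda>t. Fu (t, u0) - Fu (l, u0)) has_vector_derivative Ftu (t0, u0)) (at t0)"
    by (rule has_vector_derivative_transform_within_open[where S="{l<..<t0 + d}"])
       (use d eq in \<open>auto simp: l_def\<close>)
  then have "((\<lambda>t. Fu (t, u0) - Fu (l, u0) + Fu (l, u0)) has_vector_derivative Ftu (t0, u0)) (at t0)"
    by (subst has_vector_derivative_add_const)
  then show ?thesis by (simp add: Ftu_def)
qed

section \<open>Bilinear forms with moving arguments\<close>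

lemma bilinear_euclidean_expansion:
  fixes a b :: "'a::euclidean_space" and B :: "'a \<Rightarrow> 'a \<Rightarrow> real"
  assumes "bilinear B"
  shows "B a b = (\<Sum>i\<in>Basis. \<Sum>j\<in>Basis. (a \<bullet> i) * (b \<bullet> j) * B i j)"
proof -
  have "B a b = B (\<Sum>i\<in>Basis. (a \<bullet> i) *\<^sub>R i) (\<Sum>j\<in>Basis. (b \<bullet> j) *\<^sub>R j)"
    by (simp add: euclidean_representation)
  also have "\<dots> = (\<Sum>(i, j)\<in>Basis \<times> Basis. B ((a \<bullet> i) *\<^sub>R i) ((b \<bullet> j) *\<^sub>R j))"
    by (rule bilinear_sum[OF assms])
  finally show ?thesis
    by (simp add: sum.cartesian_product bilinear_lmul[OF assms] bilinear_rmul[OF assms] mult_ac)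
qed

text \<open>Differentiability in the base point is known only for fixed arguments. The form is
  therefore expanded into its entries on basis vectors, differentiated termwise, and folded
  back.\<close>

lemma has_vector_derivative_bilinear_form_along:
  fixes G :: "'a::euclidean_space \<Rightarrow> 'a \<Rightarrow> 'a \<Rightarrow> real" and x w1 w2 :: "real \<Rightarrow> 'a"
  assumes S: "open S" "x t \<in> S" and bil: "\<And>z. z \<in> S \<Longrightarrow> bilinear (G z)"
    and diff: "\<And>a b. (\<lambda>z. G z a b) differentiable (at (x t))"
    and x: "(x has_vector_derivative x') (at t)"
    and w1: "(w1 has_vector_derivative w1') (at t)"
    and w2: "(w2 has_vector_derivative w2') (at t)"
  shows "((\<lambda>s. G (x s) (w1 s) (w2 s)) has_real_derivative
      frechet_derivative (\<lambda>z. G z (w1 t) (w2 t)) (at (x t)) x'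
      + G (x t) w1' (w2 t) + G (x t) (w1 t) w2') (at t)"
proof -
  define D where "D a b = frechet_derivative (\<lambda>z. G z a b) (at (x t))" for a b
  have D: "((\<lambda>z. G z a b) has_derivative D a b) (at (x t))" for a b
    unfolding D_def using diff by (subst (asm) frechet_derivative_works)
  have xD: "(x has_derivative (\<lambda>h. h *\<^sub>R x')) (at t)"
    using x has_vector_derivative_def by blast
  have Dx: "((\<lambda>s. G (x s) a b) has_real_derivative D a b x') (at t)" for a b
    unfolding has_real_derivative_iff_has_vector_derivative has_vector_derivative_def
    using has_derivative_compose[OF xD D] by (simp only: linear_cmul[OF has_derivative_linear[OF D]])
  have c: "((\<lambda>s. w s \<bullet> i) has_real_derivative w' \<bullet> i) (at t)"
    if "(w has_vector_derivative w') (at t)" for w w' :: "_" and i :: 'a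
    using bounded_linear.has_vector_derivative[OF bounded_linear_inner_left that]
    by (simp add: has_real_derivative_iff_has_vector_derivative)
  have "((\<lambda>z. G z a b) has_derivative
        (\<lambda>h. \<Sum>i\<in>Basis. \<Sum>j\<in>Basis. (a \<bullet> i) * (b \<bullet> j) * D i j h)) (at (x t))" for a b
  proof -
    have "((\<lambda>z. \<Sum>i\<in>Basis. \<Sum>j\<in>Basis. (a \<bullet> i) * (b \<bullet> j) * G z i j) has_derivative
        (\<lambda>h. \<Sum>i\<in>Basis. \<Sum>j\<in>Basis. (a \<bullet> i) * (b \<bullet> j) * D i j h)) (at (x t))"
      by (intro has_derivative_sum has_derivative_mult_right D)
    then show ?thesis
      by (rule has_derivative_transform_within_open[OF _ S])
         (rule bilinear_euclidean_expansion[OF bil, symmetric])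
  qed
  \<comment> \<open>The derivative in the base point is again bilinear in a and b; this is what
    folds the first group of terms back into \<open>D (w1 t) (w2 t) x'\<close>.\<close>
  then have DG: "D a b = (\<lambda>h. \<Sum>i\<in>Basis. \<Sum>j\<in>Basis. (a \<bullet> i) * (b \<bullet> j) * D i j h)" for a b
    unfolding D_def[of a b] by (rule frechet_derivative_at[symmetric])
  have "((\<lambda>s. \<Sum>i\<in>Basis. \<Sum>j\<in>Basis. ((w1 s \<bullet> i) * (w2 s \<bullet> j)) * G (x s) i j)
      has_real_derivative
      (\<Sum>i\<in>Basis. \<Sum>j\<in>Basis. (w1 t \<bullet> i) * (w2 t \<bullet> j) * D i j x'
         + (w1' \<bullet> i) * (w2 t \<bullet> j) * G (x t) i j + (w1 t \<bullet> i) * (w2' \<bullet> j) * G (x t) i j)) (at t)"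
    by (intro DERIV_sum)
       (rule DERIV_cong[OF DERIV_mult[OF DERIV_mult[OF c[OF w1] c[OF w2]] Dx]], simp add: algebra_simps)
  also have "(\<Sum>i\<in>Basis. \<Sum>j\<in>Basis. (w1 t \<bullet> i) * (w2 t \<bullet> j) * D i j x'
         + (w1' \<bullet> i) * (w2 t \<bullet> j) * G (x t) i j + (w1 t \<bullet> i) * (w2' \<bullet> j) * G (x t) i j)
      = D (w1 t) (w2 t) x' + G (x t) w1' (w2 t) + G (x t) (w1 t) w2'"
    unfolding sum.distrib DG[of "w1 t" "w2 t"]
    by (simp only: bilinear_euclidean_expansion[OF bil[OF S(2)], symmetric])
  finally have *: "((\<lambda>s. \<Sum>i\<in>Basis. \<Sum>j\<in>Basis. ((w1 s \<bullet> i) * (w2 s \<bullet> j)) * G (x s) i j)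
      has_real_derivative D (w1 t) (w2 t) x' + G (x t) w1' (w2 t) + G (x t) (w1 t) w2') (at t)" .
  have "isCont x t" using x by (rule has_vector_derivative_continuous)
  then have "\<forall>\<^sub>F s in nhds t. x s \<in> S"
    unfolding eventually_nhds_conv_at isCont_def using S topological_tendstoD[OF _ S] by blast
  then have "\<forall>\<^sub>F s in nhds t. (\<Sum>i\<in>Basis. \<Sum>j\<in>Basis. ((w1 s \<bullet> i) * (w2 s \<bullet> j)) * G (x s) i j)
      = G (x s) (w1 s) (w2 s)"
    by eventually_elim (rule bilinear_euclidean_expansion[OF bil, symmetric])
  from DERIV_cong_ev[OF refl this refl] show ?thesis using * unfolding D_def by blast
qed

subsection \<open>Flat metrics \<open>du\<^sup>2 + E(u) dv\<^sup>2\<close>\<close>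

text \<open>Both the coefficients of a metric du^2 + E(u) dv^2 and its Christoffel symbols depend on
  u alone, so all partial derivatives in the curvature formula are instances of this one.\<close>

lemma partial_deriv_first_coordinate:
  fixes F :: "real ^ 2 \<Rightarrow> real"
  assumes "open R" "y \<in> R" "\<And>z. z \<in> R \<Longrightarrow> F z = k (z $ 1)"
    and "(k has_real_derivative k') (at (y $ 1))"
  shows "partial_deriv i F y = (if i = 1 then k' else 0)"
proof -
  have "((\<lambda>z::real^2. z $ 1) has_derivative (\<lambda>h. h $ 1)) (at y)"
    by (rule bounded_linear_imp_has_derivative[OF bounded_linear_vec_nth])
  from has_derivative_compose[OF this, of k "\<lambda>h. k' * h"]
  have "((\<lambda>z. k (z $ 1)) has_derivative (\<lambda>h. k' * h $ 1)) (at y)"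
    using assms(4) by (simp add: has_field_derivative_def)
  then have "(F has_derivative (\<lambda>h. k' * h $ 1)) (at y)"
    by (rule has_derivative_transform_within_open[OF _ assms(1,2)]) (simp add: assms(3))
  from frechet_derivative_at[OF this, symmetric] show ?thesis
    by (simp add: partial_deriv_def axis_def)
qed

text \<open>\<open>matrix_inv\<close> chooses some two-sided inverse, so exhibiting one is not
  enough: uniqueness of the inverse pins down the choice.\<close>

lemma matrix_inv_diag_2:
  fixes H :: "real ^ 2 ^ 2"
  assumes H: "H = vector [vector [1, 0], vector [0, e]]" and e: "e \<noteq> 0"
  shows "matrix_inv H = vector [vector [1, 0], vector [0, 1 / e]]"
proof -
  let ?B = "vector [vector [1, 0], vector [0, 1 / e]] :: real ^ 2 ^ 2"
  have "H ** ?B = mat 1" "?B ** H = mat 1"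
    using e unfolding H matrix_matrix_mult_def mat_def vec_eq_iff forall_2 sum_2
    by (simp_all add: vector_2)
  moreover have "A = ?B" if "H ** A = mat 1" "A ** H = mat 1" for A
  proof -
    have "A = A ** (H ** ?B)" using \<open>H ** ?B = mat 1\<close> by (simp add: matrix_mul_rid)
    also have "\<dots> = ?B" using that(2) by (simp only: matrix_mul_assoc matrix_mul_lid)
    finally show ?thesis .
  qed
  ultimately show ?thesis
    unfolding matrix_inv_def by (intro some_equality) blast+
qed

text \<open>For a metric \<open>du\<^sup>2 + E(u) dv\<^sup>2\<close> the only nonzero Christoffel symbols are
  \<open>\<Gamma>\<^sup>1\<^sub>2\<^sub>2 = -E'/2\<close> and \<open>\<Gamma>\<^sup>2\<^sub>1\<^sub>2 = \<Gamma>\<^sup>2\<^sub>2\<^sub>1 = E'/(2E)\<close>.\<close>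

lemma gauss_curvature_in_warped:
  fixes H :: "real ^ 2 \<Rightarrow> real ^ 2 ^ 2"
  assumes R: "open R" and H: "\<And>z. z \<in> R \<Longrightarrow> H z = vector [vector [1, 0], vector [0, E (z $ 1)]]"
    and E: "\<And>z. z \<in> R \<Longrightarrow> E (z $ 1) > 0"
    and E1: "\<And>z. z \<in> R \<Longrightarrow> (E has_real_derivative E1 (z $ 1)) (at (z $ 1))"
    and E2: "\<And>z. z \<in> R \<Longrightarrow> (E1 has_real_derivative E2 (z $ 1)) (at (z $ 1))"
    and y: "y \<in> R"
  shows "gauss_curvature_in H y = ((E1 (y $ 1))\<^sup>2 / (4 * E (y $ 1)) - E2 (y $ 1) / 2) / E (y $ 1)"
proof -
  have pd: "partial_deriv i (\<lambda>z. H z $ j $ l) z = (if i = 1 \<and> j = 2 \<and> l = 2 then E1 (z $ 1) else 0)"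
    if z: "z \<in> R" for i j l z
  proof -
    have "partial_deriv i (\<lambda>z. H z $ j $ l) z = (if i = 1 then (if j = 2 \<and> l = 2 then E1 (z $ 1) else 0) else 0)"
    proof (rule partial_deriv_first_coordinate[OF R z])
      show "H w $ j $ l = (\<lambda>u. if j = 2 \<and> l = 2 then E u else if j = l then 1 else 0) (w $ 1)"
        if "w \<in> R" for w
        using exhaust_2[of j] exhaust_2[of l] by (auto simp: H[OF that] vector_2)
    qed (use E1[OF z] in auto)
    then show ?thesis by simp
  qed
  have Gam: "christoffel H k i j z =
      (if k = 1 \<and> i = 2 \<and> j = 2 then - E1 (z $ 1) / 2
       else if k = 2 \<and> i \<noteq> j then E1 (z $ 1) / (2 * E (z $ 1)) else 0)" if z: "z \<in> R" for k i j z
  proof -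
    have "E (z $ 1) \<noteq> 0" using E[OF z] by simp
    then show ?thesis
      using exhaust_2[of k] exhaust_2[of i] exhaust_2[of j] unfolding christoffel_def
      by (auto simp: pd[OF z] sum_2 matrix_inv_diag_2[OF H[OF z]] vector_2)
  qed
  have Ey: "E (y $ 1) > 0" using E[OF y] .
  have p1: "partial_deriv 1 (christoffel H 1 2 2) y = - E2 (y $ 1) / 2"
  proof -
    have "partial_deriv 1 (christoffel H 1 2 2) y = (if (1::2) = 1 then - E2 (y $ 1) / 2 else 0)"
    proof (rule partial_deriv_first_coordinate[OF R y])
      show "christoffel H 1 2 2 z = (\<lambda>u. - E1 u / 2) (z $ 1)" if "z \<in> R" for z
        by (simp add: Gam[OF that])
      show "((\<lambda>u. - E1 u / 2) has_real_derivative - E2 (y $ 1) / 2) (at (y $ 1))"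
        using E2[OF y] by (auto intro!: derivative_eq_intros)
    qed
    then show ?thesis by simp
  qed
  have p2: "partial_deriv 2 (christoffel H 1 1 2) y = 0"
  proof -
    have "partial_deriv 2 (christoffel H 1 1 2) y = (if (2::2) = 1 then 0 else 0)"
      by (rule partial_deriv_first_coordinate[OF R y, where k="\<lambda>_. 0"]) (auto simp: Gam)
    then show ?thesis by simp
  qed
  \<comment> \<open>Only the component l = 1 enters the curvature, since \<open>H y $ 2 $ 1\<close>
    is 0. Its quadratic part reduces to minus the product of the symbols -E'/2 and E'/(2E), that is
    E'^2/(4E).\<close>
  have "riemann H 1 1 2 2 y = (E1 (y $ 1))\<^sup>2 / (4 * E (y $ 1)) - E2 (y $ 1) / 2"
    unfolding riemann_def p1 p2 using Ey
    by (simp add: Gam[OF y] sum_2 power2_eq_square field_simps)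
  then show ?thesis
    unfolding gauss_curvature_in_def by (simp add: H[OF y] sum_2 vector_2 det_2)
qed

text \<open>For \<omega> = sqrt E the expression in the last hypothesis is -\<omega>''/\<omega>. Its
  vanishing reads E'' = E'^2/(2E), which is exactly the vanishing of the derivative of \<omega>' =
  E'/(2 sqrt E).\<close>

lemma sqrt_affine_of_curvature_zero:
  assumes I: "open_interval I" and E: "\<And>u. u \<in> I \<Longrightarrow> E u > 0"
    and E1: "\<And>u. u \<in> I \<Longrightarrow> (E has_real_derivative E1 u) (at u)"
    and E2: "\<And>u. u \<in> I \<Longrightarrow> (E1 has_real_derivative E2 u) (at u)"
    and K: "\<And>u. u \<in> I \<Longrightarrow> ((E1 u)\<^sup>2 / (4 * E u) - E2 u / 2) / E u = 0"
  shows "\<exists>a. \<forall>u\<in>I. ((\<lambda>u. sqrt (E u)) has_real_derivative a) (at u)"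
proof -
  have d1: "((\<lambda>u. sqrt (E u)) has_real_derivative E1 u / (2 * sqrt (E u))) (at u)" if "u \<in> I" for u
    using E[OF that] E1[OF that]
    by (auto intro!: derivative_eq_intros simp: field_simps)
  have d2: "((\<lambda>u. E1 u / (2 * sqrt (E u))) has_real_derivative 0) (at u)" if u: "u \<in> I" for u
  proof -
    have "E2 u = (E1 u)\<^sup>2 / (2 * E u)" using K[OF u] E[OF u] by (simp add: field_simps)
    moreover have "((\<lambda>u. E1 u / (2 * sqrt (E u))) has_real_derivative
      (E2 u * (2 * sqrt (E u)) - E1 u * (2 * (E1 u / (2 * sqrt (E u))))) /
        (2 * sqrt (E u) * (2 * sqrt (E u)))) (at u)"
      using E[OF u] by (intro DERIV_divide E2 u DERIV_cmult d1) auto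
    moreover have "E2 u * (2 * sqrt (E u)) - E1 u * (2 * (E1 u / (2 * sqrt (E u)))) = 0"
    proof -
      have "E2 u * (2 * sqrt (E u)) = (E1 u)\<^sup>2 * (sqrt (E u) / E u)"
        using \<open>E2 u = _\<close> by simp
      also have "sqrt (E u) / E u = 1 / sqrt (E u)"
        using real_div_sqrt[of "E u"] E[OF u] by (simp add: field_simps)
      finally show ?thesis by (simp add: power2_eq_square)
    qed
    ultimately show ?thesis by simp
  qed
  have "convex I" using I by (simp add: open_interval_def is_interval_convex)
  then have "\<exists>a. \<forall>u\<in>I. E1 u / (2 * sqrt (E u)) = a"
    using has_field_derivative_zero_constant[of I "\<lambda>u. E1 u / (2 * sqrt (E u))"] d2
    by (metis has_field_derivative_at_within)
  then show ?thesis using d1 by metis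
qed

text \<open>The hypotheses are the coordinate form of unit speed and constant angle.
  \<open>V\<close> is left as an arbitrary antiderivative of cot \<theta> / \<omega>, so that both
  shapes of the final formula come from the same argument.\<close>

lemma planar_loxodrome:
  fixes u v :: "real \<Rightarrow> real"
  assumes K: "open_interval K" and \<theta>: "0 < \<theta>" "\<theta> < pi"
    and u: "\<And>s. s \<in> K \<Longrightarrow> (u has_real_derivative u' s) (at s)" and cont: "continuous_on K u'"
    and v: "\<And>s. s \<in> K \<Longrightarrow> (v has_real_derivative v' s) (at s)"
    and speed: "\<And>s. s \<in> K \<Longrightarrow> (u' s)\<^sup>2 = (sin \<theta>)\<^sup>2"
    and angle: "\<And>s. s \<in> K \<Longrightarrow> \<omega> (u s) * v' s = cos \<theta>"
    and pos: "\<And>s. s \<in> K \<Longrightarrow> \<omega> (u s) > 0"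
    and V: "\<And>s. s \<in> K \<Longrightarrow> (V has_real_derivative cot \<theta> / \<omega> (u s)) (at (u s))"
  shows "inj_on u K" and "\<exists>\<sigma>\<in>{1, -1}. \<exists>b. \<forall>s\<in>K. v s = \<sigma> * V (u s) + b"
proof -
  have cK: "convex K" using K by (simp add: open_interval_def is_interval_convex)
  have sin0: "sin \<theta> > 0" using \<theta> by (rule sin_gt_zero)
  \<comment> \<open>A continuous function on a connected set with values in a two-point set is
    constant; this excludes a change of sign of u'.\<close>
  have "u' ` K \<subseteq> {sin \<theta>, - sin \<theta>}" using speed power2_eq_iff by auto
  then have "finite (u' ` K)" using finite_subset by blast
  then have "u' constant_on K"
    using cont cK convex_connected continuous_finite_range_constant by blast
  then obtain c where c: "\<And>s. s \<in> K \<Longrightarrow> u' s = c" unfolding constant_on_def by blast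
  obtain s1 where "s1 \<in> K" using K by (auto simp: open_interval_def)
  then have "c = sin \<theta> \<or> c = - sin \<theta>" using speed c power2_eq_iff by metis
  then have "\<exists>\<sigma>\<in>{1, -1::real}. c = \<sigma> * sin \<theta>" by auto
  then obtain \<sigma> where \<sigma>: "\<sigma> \<in> {1, -1::real}" "c = \<sigma> * sin \<theta>" by blast
  have "\<exists>k. \<forall>s\<in>K. u s - c * s = k"
  proof (rule has_field_derivative_zero_constant[OF cK])
    fix s assume s: "s \<in> K"
    have "((\<lambda>s. u s - c * s) has_real_derivative c - c * 1) (at s)"
      using u[OF s] by (intro DERIV_diff DERIV_cmult DERIV_ident) (simp add: c[OF s])
    then show "((\<lambda>s. u s - c * s) has_real_derivative 0) (at s within K)"
      by (simp add: has_field_derivative_at_within)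
  qed
  then obtain k where k: "\<And>s. s \<in> K \<Longrightarrow> u s = k + c * s" by (metis diff_add_cancel)
  have "c \<noteq> 0" using sin0 \<sigma> by auto
  then show "inj_on u K" by (intro inj_onI) (simp add: k)
  have "\<exists>b. \<forall>s\<in>K. v s - \<sigma> * V (u s) = b"
  proof (rule has_field_derivative_zero_constant[OF cK])
    fix s assume s: "s \<in> K"
    have "((\<lambda>s. v s - \<sigma> * V (u s)) has_real_derivative v' s - \<sigma> * (cot \<theta> / \<omega> (u s) * u' s)) (at s)"
      by (intro DERIV_diff DERIV_cmult DERIV_chain2[OF V u] v s)
    moreover have "v' s - \<sigma> * (cot \<theta> / \<omega> (u s) * u' s) = 0"
    proof -
      \<comment> \<open>The sign of u' appears once through the chain rule for V(u(s)) and once as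
        the prefactor, so it cancels against v' = cos \<theta> / \<omega>.\<close>
      have "\<sigma> * \<sigma> = 1" using \<sigma> by auto
      moreover have "v' s = cos \<theta> / \<omega> (u s)" using angle[OF s] pos[OF s] by (simp add: field_simps)
      ultimately show ?thesis using pos[OF s] sin0 c[OF s] \<sigma>(2) by (simp add: cot_def field_simps)
    qed
    ultimately show "((\<lambda>s. v s - \<sigma> * V (u s)) has_field_derivative 0) (at s within K)"
      by (metis has_field_derivative_at_within)
  qed
  then obtain b where "\<forall>s\<in>K. v s - \<sigma> * V (u s) = b" by blast
  then have "\<forall>s\<in>K. v s = \<sigma> * V (u s) + b" by (simp add: algebra_simps)
  then show "\<exists>\<sigma>\<in>{1, -1}. \<exists>b. \<forall>s\<in>K. v s = \<sigma> * V (u s) + b" using \<sigma>(1) by blast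
qed

subsection \<open>Charts, tangent vectors and differentials\<close>

lemma is_chartD:
  assumes "is_chart c"
  shows is_chart_open_dom: "open (dom_of c)"
    and is_chart_open_img: "open (img_of c)"
    and is_chart_inv_coords: "p \<in> dom_of c \<Longrightarrow> chart_inv c (coords c p) = p"
    and is_chart_coords_inv: "y \<in> img_of c \<Longrightarrow> coords c (chart_inv c y) = y"
    and is_chart_coords_in: "p \<in> dom_of c \<Longrightarrow> coords c p \<in> img_of c"
    and is_chart_inv_in: "y \<in> img_of c \<Longrightarrow> chart_inv c y \<in> dom_of c"
    and is_chart_continuous_inv: "continuous_on (img_of c) (chart_inv c)"
  using assms unfolding is_chart_def homeomorphism_def by blast+

text \<open>The image is the part of \<open>img_of c\<close> that the continuous map
  \<open>chart_inv c\<close> sends into \<open>W\<close>. It supplies the open overlap images on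
  which transition maps are differentiated.\<close>

lemma is_chart_open_image:
  assumes "is_chart c" "open W"
  shows "open (coords c ` (dom_of c \<inter> W))"
proof -
  have "coords c ` (dom_of c \<inter> W) = img_of c \<inter> chart_inv c -` W"
  proof (intro set_eqI iffI)
    fix y assume "y \<in> coords c ` (dom_of c \<inter> W)"
    then show "y \<in> img_of c \<inter> chart_inv c -` W"
      using is_chart_coords_in[OF assms(1)] is_chart_inv_coords[OF assms(1)] by auto
  next
    fix y assume "y \<in> img_of c \<inter> chart_inv c -` W"
    then show "y \<in> coords c ` (dom_of c \<inter> W)"
      using is_chart_inv_in[OF assms(1)] is_chart_coords_inv[OF assms(1)]
      by (metis IntD1 IntD2 IntI image_eqI vimageD)
  qed
  moreover have "open (img_of c \<inter> chart_inv c -` W)"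
    by (rule continuous_open_preimage[OF is_chart_continuous_inv is_chart_open_img])
       (rule assms)+
  ultimately show ?thesis by simp
qed

lemma smooth_manifold_is_chart: "smooth_manifold A \<Longrightarrow> c \<in> A \<Longrightarrow> is_chart c"
  unfolding smooth_manifold_def by blast

lemma charts_at_iff: "c \<in> charts_at A p \<longleftrightarrow> c \<in> A \<and> p \<in> dom_of c"
  by (simp add: charts_at_def)

lemma charts_at_is_chart: "smooth_manifold A \<Longrightarrow> c \<in> charts_at A p \<Longrightarrow> is_chart c"
  unfolding charts_at_def smooth_manifold_def by blast

lemma charts_at_nonempty: "smooth_manifold A \<Longrightarrow> \<exists>c. c \<in> charts_at A p"
proof -
  assume "smooth_manifold A"
  then have "(\<Union>c\<in>A. dom_of c) = UNIV" unfolding smooth_manifold_def by (elim conjE)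
  then have "p \<in> (\<Union>c\<in>A. dom_of c)" by simp
  then show ?thesis by (auto simp: charts_at_def)
qed

lemma transition_differentiable:
  assumes A: "smooth_manifold A" and c: "c \<in> charts_at A p" and d: "d \<in> charts_at A p"
  shows "(coords d \<circ> chart_inv c) differentiable (at (coords c p))"
proof -
  have "smooth_on (coords c ` (dom_of c \<inter> dom_of d)) (coords d \<circ> chart_inv c)"
    using A c d unfolding smooth_manifold_def charts_at_iff compatible_def by blast
  then show ?thesis
    by (rule smooth_on_differentiable) (use c d in \<open>auto simp: charts_at_iff\<close>)
qed

lemma transition_has_derivative:
  assumes "smooth_manifold A" "c \<in> charts_at A p" "d \<in> charts_at A p"
  shows "((coords d \<circ> chart_inv c) has_derivative
            frechet_derivative (coords d \<circ> chart_inv c) (at (coords c p))) (at (coords c p))"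
  by (rule iffD1[OF frechet_derivative_works transition_differentiable[OF assms]])

text \<open>The chain rule through the transition map, valid because the two coordinate expressions
  agree on the open image of the overlap. Tangency of coordinate vectors and chart independence of
  the differential both reduce to it.\<close>

lemma has_derivative_change_chart:
  assumes A: "smooth_manifold A" and c: "c \<in> charts_at A p" and d: "d \<in> charts_at A p"
    and F: "((F \<circ> chart_inv c) has_derivative D) (at (coords c p))"
  shows "((F \<circ> chart_inv d) has_derivative
            (\<lambda>v. D (frechet_derivative (coords c \<circ> chart_inv d) (at (coords d p)) v))) (at (coords d p))"
proof -
  have ic: "is_chart c" and id: "is_chart d" using charts_at_is_chart[OF A] c d by blast+
  have pc: "p \<in> dom_of c" and pd: "p \<in> dom_of d" using c d by (auto simp: charts_at_iff)
  have "((F \<circ> chart_inv c) has_derivative D) (at ((coords c \<circ> chart_inv d) (coords d p)))"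
    using F by (simp add: is_chart_inv_coords[OF id pd])
  from has_derivative_compose[OF transition_has_derivative[OF A d c] this]
  have "((\<lambda>y. (F \<circ> chart_inv c) ((coords c \<circ> chart_inv d) y)) has_derivative
      (\<lambda>v. D (frechet_derivative (coords c \<circ> chart_inv d) (at (coords d p)) v))) (at (coords d p))" .
  then show ?thesis
  proof (rule has_derivative_transform_within_open)
    show "open (coords d ` (dom_of d \<inter> dom_of c))"
      using is_chart_open_image[OF id is_chart_open_dom[OF ic]] .
    show "coords d p \<in> coords d ` (dom_of d \<inter> dom_of c)" using pc pd by blast
    show "(F \<circ> chart_inv c) ((coords c \<circ> chart_inv d) y) = (F \<circ> chart_inv d) y"
      if "y \<in> coords d ` (dom_of d \<inter> dom_of c)" for y
      using that by (auto simp: is_chart_inv_coords[OF id] is_chart_inv_coords[OF ic])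
  qed
qed

lemma frechet_derivative_transition_self:
  assumes "smooth_manifold A" "c \<in> charts_at A p"
  shows "frechet_derivative (coords c \<circ> chart_inv c) (at (coords c p)) = (\<lambda>v. v)"
proof (rule frechet_derivative_at[symmetric])
  have ic: "is_chart c" and pc: "p \<in> dom_of c"
    using assms charts_at_is_chart[OF assms] by (auto simp: charts_at_iff)
  show "((coords c \<circ> chart_inv c) has_derivative (\<lambda>v. v)) (at (coords c p))"
    by (rule has_derivative_transform_within_open[OF has_derivative_ident
          is_chart_open_img[OF ic] is_chart_coords_in[OF ic pc]])
       (simp add: is_chart_coords_inv[OF ic])
qed

lemma tangent_spaceI:
  assumes "\<And>c. c \<notin> charts_at A p \<Longrightarrow> \<xi> c = 0"
    and "\<And>c d. c \<in> charts_at A p \<Longrightarrow> d \<in> charts_at A p \<Longrightarrow>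
      \<xi> d = frechet_derivative (coords d \<circ> chart_inv c) (at (coords c p)) (\<xi> c)"
  shows "\<xi> \<in> tangent_space A p"
  using assms unfolding tangent_space_def by blast

lemma tangent_space_outside: "\<xi> \<in> tangent_space A p \<Longrightarrow> c \<notin> charts_at A p \<Longrightarrow> \<xi> c = 0"
  unfolding tangent_space_def by blast

lemma tangent_space_component:
  "\<xi> \<in> tangent_space A p \<Longrightarrow> c \<in> charts_at A p \<Longrightarrow> d \<in> charts_at A p \<Longrightarrow>
     \<xi> d = frechet_derivative (coords d \<circ> chart_inv c) (at (coords c p)) (\<xi> c)"
  unfolding tangent_space_def by blast

text \<open>The transformation law is the cocycle rule for derivatives of transitions: the change
  from c to e factors through d near p.\<close>

lemma coord_vec_in_tangent_space:
  assumes A: "smooth_manifold A" and c: "c \<in> charts_at A p"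
  shows "coord_vec A c p v \<in> tangent_space A p"
proof (rule tangent_spaceI)
  fix d e assume de: "d \<in> charts_at A p" "e \<in> charts_at A p"
  have "frechet_derivative (coords e \<circ> chart_inv c) (at (coords c p)) v =
      frechet_derivative (coords e \<circ> chart_inv d) (at (coords d p))
        (frechet_derivative (coords d \<circ> chart_inv c) (at (coords c p)) v)"
    by (rule fun_cong[OF frechet_derivative_at[OF has_derivative_change_chart[OF A de(1) c
          transition_has_derivative[OF A de]]], THEN sym])
  with de show "coord_vec A c p v e =
      frechet_derivative (coords e \<circ> chart_inv d) (at (coords d p)) (coord_vec A c p v d)"
    unfolding coord_vec_def by simp
qed (simp add: coord_vec_def)

lemma coord_vec_self:
  "smooth_manifold A \<Longrightarrow> c \<in> charts_at A p \<Longrightarrow> coord_vec A c p v c = v"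
  by (simp add: coord_vec_def frechet_derivative_transition_self)

text \<open>The transformation law recovers every other component from the one in \<open>c\<close>,
  and the default entry 0 settles the charts not around p. Identities between tangent vectors can
  thus be checked in one chart.\<close>

lemma tangent_space_eqI:
  assumes "\<xi> \<in> tangent_space A p" "\<eta> \<in> tangent_space A p" "c \<in> charts_at A p" "\<xi> c = \<eta> c"
  shows "\<xi> = \<eta>"
proof
  fix d
  show "\<xi> d = \<eta> d"
  proof (cases "d \<in> charts_at A p")
    case True
    then show ?thesis using assms(1,2)[THEN tangent_space_component, OF assms(3) True] assms(4) by simp
  next
    case False
    then show ?thesis using assms(1,2) tangent_space_outside by metis
  qed
qed

lemma coord_vec_component:
  assumes "smooth_manifold A" "c \<in> charts_at A p" "\<xi> \<in> tangent_space A p"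
  shows "coord_vec A c p (\<xi> c) = \<xi>"
  by (rule tangent_space_eqI[OF coord_vec_in_tangent_space[OF assms(1,2)] assms(3,2)])
     (rule coord_vec_self[OF assms(1,2)])

lemma tangent_space_lincomb:
  assumes A: "smooth_manifold A" and "\<xi> \<in> tangent_space A p" "\<eta> \<in> tangent_space A p"
  shows "(\<lambda>c. r *\<^sub>R \<xi> c + \<eta> c) \<in> tangent_space A p"
proof (rule tangent_spaceI)
  fix c assume "c \<notin> charts_at A p"
  then show "r *\<^sub>R \<xi> c + \<eta> c = 0" using assms(2,3)[THEN tangent_space_outside] by simp
next
  fix c d assume cd: "c \<in> charts_at A p" "d \<in> charts_at A p"
  show "r *\<^sub>R \<xi> d + \<eta> d =
      frechet_derivative (coords d \<circ> chart_inv c) (at (coords c p)) (r *\<^sub>R \<xi> c + \<eta> c)"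
    unfolding assms(2,3)[THEN tangent_space_component, OF cd]
    using has_derivative_linear[OF transition_has_derivative[OF A cd]]
    by (simp add: linear_add linear_cmul)
qed

lemma tangent_space_zero:
  assumes "smooth_manifold A"
  shows "(\<lambda>_. 0) \<in> tangent_space A p"
  by (rule tangent_spaceI)
     (simp_all add: linear_0[OF has_derivative_linear[OF transition_has_derivative[OF assms]]])

lemma coord_vec_lincomb:
  assumes A: "smooth_manifold A" and c: "c \<in> charts_at A p"
  shows "coord_vec A c p (r *\<^sub>R v + w) = (\<lambda>d. r *\<^sub>R coord_vec A c p v d + coord_vec A c p w d)"
  by (rule tangent_space_eqI[OF _ _ c])
     (auto intro!: tangent_space_lincomb coord_vec_in_tangent_space A c simp: coord_vec_self[OF A c])

lemma metric_eq_metric_in: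
  assumes A: "smooth_manifold A" and c: "c \<in> charts_at A p"
    and "\<xi> \<in> tangent_space A p" "\<eta> \<in> tangent_space A p"
  shows "g p \<xi> \<eta> = metric_in A g c (coords c p) (\<xi> c) (\<eta> c)"
proof -
  have "chart_inv c (coords c p) = p"
    using is_chart_inv_coords charts_at_is_chart A c charts_at_iff by metis
  then show ?thesis
    unfolding metric_in_def using assms by (simp add: coord_vec_component)
qed

text \<open>The axioms give one combined linearity law in the first argument; symmetry carries it
  over to the second.\<close>

lemma metric_in_bilinear:
  assumes A: "riemannian_manifold A g" and c: "c \<in> A" and y: "y \<in> img_of c"
  shows "bilinear (metric_in A g c y)"
proof -
  have sm: "smooth_manifold A" and rm: "riemannian_metric A g"
    using A by (auto simp: riemannian_manifold_def)
  let ?p = "chart_inv c y"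
  have cp: "c \<in> charts_at A ?p"
    using is_chart_inv_in[OF smooth_manifold_is_chart[OF sm c] y] c by (simp add: charts_at_iff)
  note T = coord_vec_in_tangent_space[OF sm cp]
  have sym: "metric_in A g c y v w = metric_in A g c y w v" for v w
    unfolding metric_in_def using rm T unfolding riemannian_metric_def by blast
  have lin: "metric_in A g c y (r *\<^sub>R v + w) z = r * metric_in A g c y v z + metric_in A g c y w z"
    for r v w z
    unfolding metric_in_def coord_vec_lincomb[OF sm cp] using rm T unfolding riemannian_metric_def by blast
  have l1: "linear (\<lambda>v. metric_in A g c y v z)" for z
  proof (rule linearI)
    show "metric_in A g c y (v + w) z = metric_in A g c y v z + metric_in A g c y w z" for v w
      using lin[of 1 v w z] by simp
    \<comment> \<open>The combined law with factor 1 and two zero vectors says that this value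
      equals its double.\<close>
    have "metric_in A g c y 0 z = 0" using lin[of 1 0 0 z] by simp
    then show "metric_in A g c y (r *\<^sub>R v) z = r *\<^sub>R metric_in A g c y v z" for r v
      using lin[of r v 0 z] by simp
  qed
  then show ?thesis unfolding bilinear_def using sym by simp
qed

text \<open>One chain rule serves three choices of \<open>F\<close>: another coordinate map, a
  smooth map read in a target chart, and a component of a vector field. Continuity of the curve is a
  separate hypothesis, because the coordinates have no meaning outside the chart domain and cannot
  by themselves keep the curve inside it.\<close>

lemma has_vector_derivative_along_curve:
  assumes A: "smooth_manifold A" and c: "c \<in> charts_at A (\<alpha> t)" and cont: "isCont \<alpha> t"
    and \<alpha>: "((coords c \<circ> \<alpha>) has_vector_derivative w) (at t)"
    and F: "((F \<circ> chart_inv c) has_derivative D) (at (coords c (\<alpha> t)))"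
  shows "((F \<circ> \<alpha>) has_vector_derivative D w) (at t)"
proof -
  have ic: "is_chart c" using charts_at_is_chart A c by blast
  have "((\<lambda>s. (F \<circ> chart_inv c) ((coords c \<circ> \<alpha>) s)) has_derivative (\<lambda>h. D (h *\<^sub>R w))) (at t)"
    by (rule has_derivative_compose[OF \<alpha>[unfolded has_vector_derivative_def]]) (simp add: F[unfolded o_def] o_def)
  then have 1: "((\<lambda>s. (F \<circ> chart_inv c) ((coords c \<circ> \<alpha>) s)) has_vector_derivative D w) (at t)"
    unfolding has_vector_derivative_def
    by (simp only: linear_cmul[OF has_derivative_linear[OF F]])
  have "\<forall>\<^sub>F s in nhds t. \<alpha> s \<in> dom_of c"
    unfolding eventually_nhds_conv_at
    using cont is_chart_open_dom[OF ic] c topological_tendstoD[of \<alpha> "\<alpha> t" "at t" "dom_of c"]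
    by (auto simp: isCont_def charts_at_iff)
  then obtain S where S: "open S" "t \<in> S" "\<And>s. s \<in> S \<Longrightarrow> \<alpha> s \<in> dom_of c"
    unfolding eventually_nhds by blast
  show ?thesis
    by (rule has_vector_derivative_transform_within_open[OF 1 S(1,2)])
       (simp add: is_chart_inv_coords[OF ic S(3)])
qed

lemma velocity_component:
  assumes "c \<in> charts_at A (\<alpha> t)" "((coords c \<circ> \<alpha>) has_vector_derivative w) (at t)"
  shows "velocity A \<alpha> t c = w"
  using assms by (simp add: velocity_def vector_derivative_at)

lemma has_vector_derivative_other_chart:
  assumes A: "smooth_manifold A" and c: "c \<in> charts_at A (\<alpha> t)" and cont: "isCont \<alpha> t"
    and \<alpha>: "((coords c \<circ> \<alpha>) has_vector_derivative w) (at t)" and d: "d \<in> charts_at A (\<alpha> t)"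
  shows "((coords d \<circ> \<alpha>) has_vector_derivative
      frechet_derivative (coords d \<circ> chart_inv c) (at (coords c (\<alpha> t))) w) (at t)"
  by (rule has_vector_derivative_along_curve[OF A c cont \<alpha> transition_has_derivative[OF A c d]])

lemma velocity_eq_coord_vec:
  assumes A: "smooth_manifold A" and c: "c \<in> charts_at A (\<alpha> t)" and cont: "isCont \<alpha> t"
    and \<alpha>: "((coords c \<circ> \<alpha>) has_vector_derivative w) (at t)"
  shows "velocity A \<alpha> t = coord_vec A c (\<alpha> t) w"
proof
  fix d
  show "velocity A \<alpha> t d = coord_vec A c (\<alpha> t) w d"
    using velocity_component[OF _ has_vector_derivative_other_chart[OF assms]]
    by (cases "d \<in> charts_at A (\<alpha> t)") (auto simp: velocity_def coord_vec_def)
qed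

lemma velocity_in_tangent_space:
  assumes A: "smooth_manifold A" and c: "c \<in> charts_at A (\<alpha> t)" and cont: "isCont \<alpha> t"
    and \<alpha>: "((coords c \<circ> \<alpha>) has_vector_derivative w) (at t)"
  shows "velocity A \<alpha> t \<in> tangent_space A (\<alpha> t)"
  using velocity_eq_coord_vec[OF assms] coord_vec_in_tangent_space[OF A c] by simp

lemma velocity_cong:
  assumes "open S" "t \<in> S" "\<And>s. s \<in> S \<Longrightarrow> \<alpha> s = \<beta> s"
  shows "velocity A \<alpha> t = velocity A \<beta> t"
proof -
  have "\<forall>\<^sub>F s in nhds t. (coords c \<circ> \<alpha>) s = (coords c \<circ> \<beta>) s" for c :: "('a, 'b) chart"
    unfolding eventually_nhds using assms by auto
  then have "vector_derivative (coords c \<circ> \<alpha>) (at t) = vector_derivative (coords c \<circ> \<beta>) (at t)"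
    for c :: "('a, 'b) chart"
    by (intro vector_derivative_cong_eq refl) auto
  then show ?thesis using assms(2,3) by (auto simp: velocity_def)
qed

section \<open>Smooth maps, their differentials, and velocities of curves\<close>

lemma smooth_map_on_has_derivative:
  assumes "smooth_map_on A B W F" "p \<in> W" "c \<in> charts_at A p" "d \<in> charts_at B (F p)"
  shows "((coords d \<circ> F \<circ> chart_inv c) has_derivative
           frechet_derivative (coords d \<circ> F \<circ> chart_inv c) (at (coords c p))) (at (coords c p))"
proof (rule smooth_on_has_derivative)
  show "smooth_on (coords c ` (dom_of c \<inter> W \<inter> F -` dom_of d)) (coords d \<circ> F \<circ> chart_inv c)"
    using assms unfolding smooth_map_on_def charts_at_iff by blast
  show "coords c p \<in> coords c ` (dom_of c \<inter> W \<inter> F -` dom_of d)"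
    using assms by (auto simp: charts_at_iff)
qed

text \<open>\<open>differential\<close> computes in a chosen chart. In passing to another one, the
  transition derivative from the chain rule cancels against the transformation law of \<xi>.\<close>

lemma differential_component:
  assumes A: "smooth_manifold A" and F: "smooth_map_on A B W F" and p: "p \<in> W"
    and \<xi>: "\<xi> \<in> tangent_space A p" and c: "c \<in> charts_at A p" and d: "d \<in> charts_at B (F p)"
  shows "differential A B F p \<xi> d = frechet_derivative (coords d \<circ> F \<circ> chart_inv c) (at (coords c p)) (\<xi> c)"
proof -
  define e where "e = (SOME e. e \<in> charts_at A p)"
  have e: "e \<in> charts_at A p" unfolding e_def using c by (rule someI)
  have "frechet_derivative (coords d \<circ> F \<circ> chart_inv e) (at (coords e p)) =
    (\<lambda>v. frechet_derivative (coords d \<circ> F \<circ> chart_inv c) (at (coords c p))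
        (frechet_derivative (coords c \<circ> chart_inv e) (at (coords e p)) v))"
    using has_derivative_change_chart[OF A c e, of "coords d \<circ> F"]
      smooth_map_on_has_derivative[OF F p c d] by (metis frechet_derivative_at)
  moreover have "\<xi> c = frechet_derivative (coords c \<circ> chart_inv e) (at (coords e p)) (\<xi> e)"
    by (rule tangent_space_component[OF \<xi> e c])
  ultimately show ?thesis
    using d unfolding differential_def Let_def e_def[symmetric] by simp
qed

text \<open>This is how differentials are evaluated in all geometric steps: a vector is realized as
  a velocity, and its image is the velocity of the image curve. Outside the charts around the image
  point both sides are 0 by convention.\<close>

lemma differential_velocity:
  assumes A: "smooth_manifold A" and F: "smooth_map_on A B W F" and p: "\<alpha> t \<in> W"
    and c: "c \<in> charts_at A (\<alpha> t)" and cont: "isCont \<alpha> t"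
    and \<alpha>: "((coords c \<circ> \<alpha>) has_vector_derivative w) (at t)"
  shows "differential A B F (\<alpha> t) (velocity A \<alpha> t) = velocity B (F \<circ> \<alpha>) t"
proof
  fix d
  show "differential A B F (\<alpha> t) (velocity A \<alpha> t) d = velocity B (F \<circ> \<alpha>) t d"
  proof (cases "d \<in> charts_at B (F (\<alpha> t))")
    case True
    have "((coords d \<circ> F \<circ> \<alpha>) has_vector_derivative
        frechet_derivative (coords d \<circ> F \<circ> chart_inv c) (at (coords c (\<alpha> t))) w) (at t)"
      by (rule has_vector_derivative_along_curve[OF A c cont \<alpha>
            smooth_map_on_has_derivative[OF F p c True]])
    then show ?thesis
      using True differential_component[OF A F p velocity_in_tangent_space[OF A c cont \<alpha>] c True]
      by (simp add: velocity_component[of c, OF c \<alpha>] velocity_component[of d] comp_assoc)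
  next
    case False
    then show ?thesis by (simp add: differential_def velocity_def Let_def)
  qed
qed

lemma smooth_curve_at:
  assumes "smooth_curve A I \<alpha>" "t \<in> I" "c \<in> charts_at A (\<alpha> t)"
  shows "isCont \<alpha> t" and "((coords c \<circ> \<alpha>) has_vector_derivative velocity A \<alpha> t c) (at t)"
proof -
  have "open I" using assms by (simp add: smooth_curve_def open_interval_def)
  then show "isCont \<alpha> t" using assms by (simp add: smooth_curve_def continuous_on_eq_continuous_at)
  have "(coords c \<circ> \<alpha>) differentiable (at t)"
    by (rule smooth_on_differentiable[of "I \<inter> \<alpha> -` dom_of c"])
       (use assms in \<open>auto simp: smooth_curve_def charts_at_iff\<close>)
  then show "((coords c \<circ> \<alpha>) has_vector_derivative velocity A \<alpha> t c) (at t)"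
    using assms(3) by (simp add: velocity_def vector_derivative_works)
qed

lemma smooth_curve_velocity:
  assumes "smooth_manifold A" "smooth_curve A I \<alpha>" "t \<in> I"
  shows "velocity A \<alpha> t \<in> tangent_space A (\<alpha> t)"
  using charts_at_nonempty[OF assms(1)] velocity_in_tangent_space[OF assms(1)]
    smooth_curve_at[OF assms(2,3)] by metis

lemma chart_curve:
  assumes A: "smooth_manifold A" and c: "c \<in> A" and S: "open S" "t \<in> S"
    and x: "\<And>s. s \<in> S \<Longrightarrow> x s \<in> img_of c" and x': "(x has_vector_derivative w) (at t)"
  shows "isCont (\<lambda>s. chart_inv c (x s)) t"
    and "((coords c \<circ> (\<lambda>s. chart_inv c (x s))) has_vector_derivative w) (at t)"
    and "c \<in> charts_at A (chart_inv c (x t))"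
proof -
  have ic: "is_chart c" using smooth_manifold_is_chart A c by blast
  have xt: "x t \<in> img_of c" using x S by blast
  show "c \<in> charts_at A (chart_inv c (x t))"
    using c is_chart_inv_in[OF ic xt] by (simp add: charts_at_iff)
  have "isCont (chart_inv c) (x t)"
    using is_chart_continuous_inv[OF ic] is_chart_open_img[OF ic] xt
    by (simp add: continuous_on_eq_continuous_at)
  then show "isCont (\<lambda>s. chart_inv c (x s)) t"
    by (rule isCont_o2[OF has_vector_derivative_continuous[OF x']])
  show "((coords c \<circ> (\<lambda>s. chart_inv c (x s))) has_vector_derivative w) (at t)"
    by (rule has_vector_derivative_transform_within_open[OF x' S])
       (simp add: is_chart_coords_inv[OF ic x])
qed

lemma smooth_on_has_real_derivative:
  fixes f :: "real \<Rightarrow> real"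
  assumes "smooth_on S f" "s \<in> S"
  shows "(f has_real_derivative frechet_derivative f (at s) 1) (at s)"
  using has_derivative_line[of f "frechet_derivative f (at s)" 0 s 1] smooth_on_has_derivative[OF assms]
  by (simp add: has_real_derivative_iff_has_vector_derivative)

lemma differential_lincomb:
  assumes A: "smooth_manifold A" and F: "smooth_map_on A B W F" and p: "p \<in> W"
    and \<xi>: "\<xi> \<in> tangent_space A p" and \<eta>: "\<eta> \<in> tangent_space A p"
  shows "differential A B F p (\<lambda>c. r *\<^sub>R \<xi> c + \<eta> c) =
    (\<lambda>d. r *\<^sub>R differential A B F p \<xi> d + differential A B F p \<eta> d)"
proof
  fix d
  obtain c where c: "c \<in> charts_at A p" using charts_at_nonempty[OF A] by blast
  show "differential A B F p (\<lambda>c. r *\<^sub>R \<xi> c + \<eta> c) d =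
    r *\<^sub>R differential A B F p \<xi> d + differential A B F p \<eta> d"
  proof (cases "d \<in> charts_at B (F p)")
    case True
    note lin = has_derivative_linear[OF smooth_map_on_has_derivative[OF F p c True]]
    note comp = differential_component[OF A F p _ c True]
    show ?thesis
      unfolding comp[OF \<xi>] comp[OF \<eta>] comp[OF tangent_space_lincomb[OF A \<xi> \<eta>]]
      by (simp add: linear_add[OF lin] linear_cmul[OF lin])
  next
    case False
    then show ?thesis by (simp add: differential_def Let_def)
  qed
qed

lemma differential_zero:
  assumes "smooth_manifold A" "smooth_map_on A B W F" "p \<in> W"
  shows "differential A B F p (\<lambda>_. 0) = (\<lambda>_. 0)"
proof -
  note z = tangent_space_zero[OF assms(1), of p]
  \<comment> \<open>With factor -1 and both vectors zero, the two terms on the right of the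
    linearity law cancel.\<close>
  show ?thesis
    using differential_lincomb[OF assms z z, of "-1"] by (simp add: fun_eq_iff)
qed

section \<open>Linear algebra of the metric on a tangent space\<close>

lemma riemannian_metricD:
  assumes "riemannian_manifold A g" "\<xi> \<in> tangent_space A p" "\<eta> \<in> tangent_space A p"
  shows metric_commute: "g p \<xi> \<eta> = g p \<eta> \<xi>"
    and metric_lincomb: "\<zeta> \<in> tangent_space A p \<Longrightarrow>
      g p (\<lambda>c. r *\<^sub>R \<xi> c + \<eta> c) \<zeta> = r * g p \<xi> \<zeta> + g p \<eta> \<zeta>"
    and metric_pos: "\<xi> \<noteq> (\<lambda>_. 0) \<Longrightarrow> g p \<xi> \<xi> > 0"
  using assms unfolding riemannian_manifold_def riemannian_metric_def by blast+

lemma metric_zero: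
  assumes "riemannian_manifold A g" "\<zeta> \<in> tangent_space A p"
  shows "g p (\<lambda>_. 0) \<zeta> = 0"
proof -
  have z: "(\<lambda>_. 0) \<in> tangent_space A p"
    using assms(1) tangent_space_zero unfolding riemannian_manifold_def by blast
  show ?thesis using metric_lincomb[where r = "-1", OF assms(1) z z assms(2)] by simp
qed

lemma metric_lincomb2:
  assumes A: "riemannian_manifold A g"
    and T: "\<xi> \<in> tangent_space A p" "\<eta> \<in> tangent_space A p" "\<zeta> \<in> tangent_space A p"
  shows "g p (\<lambda>c. a *\<^sub>R \<xi> c + b *\<^sub>R \<eta> c) \<zeta> = a * g p \<xi> \<zeta> + b * g p \<eta> \<zeta>"
proof -
  have sm: "smooth_manifold A" using A by (simp add: riemannian_manifold_def)
  have z: "(\<lambda>_. 0) \<in> tangent_space A p" by (rule tangent_space_zero[OF sm])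
  have b\<eta>: "(\<lambda>c. b *\<^sub>R \<eta> c) \<in> tangent_space A p"
    using tangent_space_lincomb[OF sm T(2) z, of b] by simp
  have "g p (\<lambda>c. b *\<^sub>R \<eta> c) \<zeta> = b * g p \<eta> \<zeta>"
    using metric_lincomb[OF A T(2) z T(3), of b] metric_zero[OF A T(3)] by simp
  then show ?thesis using metric_lincomb[OF A T(1) b\<eta> T(3)] by simp
qed

lemma metric_square_lincomb2:
  fixes a b :: real
  assumes A: "riemannian_manifold A g"
    and T: "\<xi> \<in> tangent_space A p" "\<eta> \<in> tangent_space A p"
  defines "\<zeta> \<equiv> (\<lambda>c. a *\<^sub>R \<xi> c + b *\<^sub>R \<eta> c)"
  shows "g p \<zeta> \<zeta> = a\<^sup>2 * g p \<xi> \<xi> + 2 * a * b * g p \<xi> \<eta> + b\<^sup>2 * g p \<eta> \<eta>"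
proof -
  have sm: "smooth_manifold A" using A by (simp add: riemannian_manifold_def)
  have b\<eta>: "(\<lambda>c. b *\<^sub>R \<eta> c) \<in> tangent_space A p"
    using tangent_space_lincomb[OF sm T(2) tangent_space_zero[OF sm], of b] by simp
  have z: "\<zeta> \<in> tangent_space A p" unfolding \<zeta>_def by (rule tangent_space_lincomb[OF sm T(1) b\<eta>])
  have "g p \<zeta> \<zeta> = a * g p \<xi> \<zeta> + b * g p \<eta> \<zeta>"
    using metric_lincomb2[OF A T z, of a b] by (simp add: \<zeta>_def)
  moreover have "g p \<xi> \<zeta> = a * g p \<xi> \<xi> + b * g p \<xi> \<eta>"
    using metric_lincomb2[OF A T T(1), of a b] metric_commute[OF A T(1) z] metric_commute[OF A T]
    by (simp add: \<zeta>_def)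
  moreover have "g p \<eta> \<zeta> = a * g p \<xi> \<eta> + b * g p \<eta> \<eta>"
    using metric_lincomb2[OF A T T(2), of a b] metric_commute[OF A T(2) z]
    by (simp add: \<zeta>_def)
  ultimately show ?thesis by (simp add: power2_eq_square algebra_simps)
qed

subsection \<open>Flows of Killing fields\<close>

lemma flow_isCont:
  fixes N :: "('a::t2_space, 'n::finite) chart set" and a :: "'u::t2_space \<Rightarrow> real"
  assumes "flow_of N X \<phi>" "isCont a u" "isCont b u"
  shows "isCont (\<lambda>s. \<phi> (a s) (b s)) u"
proof -
  have "isCont (\<lambda>(t, p). \<phi> t p) (a u, b u)"
  proof -
    have "continuous_on UNIV (\<lambda>(t, p). \<phi> t p)"
      using assms(1) unfolding flow_of_def smooth_family_def by blast
    then show ?thesis by (simp add: continuous_on_eq_continuous_at)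
  qed
  from isCont_o2[OF isCont_Pair[OF assms(2,3)] this] show ?thesis by simp
qed

lemma flow_chart_smooth:
  assumes "flow_of N X \<phi>" "c \<in> N" "d \<in> N"
  shows "smooth_on {(t, y). y \<in> img_of c \<and> \<phi> t (chart_inv c y) \<in> dom_of d}
           (\<lambda>(t, y). coords d (\<phi> t (chart_inv c y)))"
  using assms unfolding flow_of_def smooth_family_def by blast

text \<open>\<open>flow_of\<close> prescribes only the value of \<open>velocity\<close>, which is
  informative only where the derivative exists. Joint smoothness of the flow provides that
  existence, and then the prescribed value is the true derivative.\<close>

lemma flow_curve:
  assumes N: "smooth_manifold N" and fl: "flow_of N X \<phi>" and c: "c \<in> charts_at N (\<phi> t p)"
  shows "isCont (\<lambda>s. \<phi> s p) t"
    and "((coords c \<circ> (\<lambda>s. \<phi> s p)) has_vector_derivative X (\<phi> t p) c) (at t)"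
proof -
  show "isCont (\<lambda>s. \<phi> s p) t" by (rule flow_isCont[OF fl]) auto
  obtain b where b: "b \<in> charts_at N p" using charts_at_nonempty[OF N] by blast
  have ib: "is_chart b" using charts_at_is_chart[OF N b] .
  have bN: "b \<in> N" and pb: "p \<in> dom_of b" and cN: "c \<in> N" using b c by (auto simp: charts_at_iff)
  let ?F = "\<lambda>(t, y). coords c (\<phi> t (chart_inv b y))"
  have "(?F has_derivative frechet_derivative ?F (at (t, coords b p))) (at (t, coords b p))"
    by (rule smooth_on_has_derivative[OF flow_chart_smooth[OF fl bN cN]])
       (use c is_chart_coords_in[OF ib pb] is_chart_inv_coords[OF ib pb] in \<open>auto simp: charts_at_iff\<close>)
  from has_vector_derivative_fst[OF this]
  have 1: "((coords c \<circ> (\<lambda>s. \<phi> s p)) has_vector_derivative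
      frechet_derivative ?F (at (t, coords b p)) (1, 0)) (at t)"
    by (simp add: is_chart_inv_coords[OF ib pb] o_def)
  have "velocity N (\<lambda>s. \<phi> s p) t = X (\<phi> t p)" using fl by (simp add: flow_of_def)
  then have "X (\<phi> t p) c = frechet_derivative ?F (at (t, coords b p)) (1, 0)"
    using velocity_component[of c N "\<lambda>s. \<phi> s p" t, OF c 1] by simp
  with 1 show "((coords c \<circ> (\<lambda>s. \<phi> s p)) has_vector_derivative X (\<phi> t p) c) (at t)" by simp
qed

lemma killing_fieldD:
  assumes "killing_field N g X"
  shows killing_tangent: "X p \<in> tangent_space N p"
    and killing_smooth: "c \<in> N \<Longrightarrow> smooth_on (img_of c) (\<lambda>y. X (chart_inv c y) c)"
    and killing_equation: "c \<in> N \<Longrightarrow> y \<in> img_of c \<Longrightarrow>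
      frechet_derivative (\<lambda>z. metric_in N g c z v w) (at y) (X (chart_inv c y) c)
      + metric_in N g c y (frechet_derivative (\<lambda>z. X (chart_inv c z) c) (at y) v) w
      + metric_in N g c y v (frechet_derivative (\<lambda>z. X (chart_inv c z) c) (at y) w) = 0"
  using assms unfolding killing_field_def smooth_vector_field_def Let_def by blast+

text \<open>A field \<open>\<eta>\<close> along an orbit is Lie transported if \<open>\<eta>' = DX(\<eta>)\<close> in every chart, that is
  \<open>[X, \<eta>] = 0\<close>; both \<open>X\<close> and the pushforwards of a vector by the flow are.\<close>

definition lie_transported ::
    "('a, 'n::finite) chart set \<Rightarrow> ('a \<Rightarrow> ('a, 'n) tvec) \<Rightarrow> (real \<Rightarrow> 'a \<Rightarrow> 'a) \<Rightarrow> 'a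
      \<Rightarrow> (real \<Rightarrow> ('a, 'n) tvec) \<Rightarrow> bool"
  where "lie_transported N X \<phi> p \<eta> \<longleftrightarrow>
    (\<forall>t. \<eta> t \<in> tangent_space N (\<phi> t p) \<and>
      (\<forall>d\<in>charts_at N (\<phi> t p). ((\<lambda>s. \<eta> s d) has_vector_derivative
         frechet_derivative (\<lambda>z. X (chart_inv d z) d) (at (coords d (\<phi> t p))) (\<eta> t d)) (at t)))"

text \<open>In a chart the product rule yields the derivative of the metric along \<open>X\<close>
  plus one term for each transported argument, and this sum is the Killing equation. The chart may
  depend on t: a zero derivative is checked at each time separately, and constancy follows on the
  whole real line.\<close>

lemma metric_lie_transported_constant:
  assumes rm: "riemannian_manifold N g" and kf: "killing_field N g X" and fl: "flow_of N X \<phi>"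
    and \<eta>: "lie_transported N X \<phi> p \<eta>" and \<zeta>: "lie_transported N X \<phi> p \<zeta>"
  shows "g (\<phi> s p) (\<eta> s) (\<zeta> s) = g (\<phi> t p) (\<eta> t) (\<zeta> t)"
proof (rule DERIV_isconst_all[where f = "\<lambda>t. g (\<phi> t p) (\<eta> t) (\<zeta> t)"], intro allI)
  fix t
  have N: "smooth_manifold N" and met: "riemannian_metric N g"
    using rm by (auto simp: riemannian_manifold_def)
  obtain d where d: "d \<in> charts_at N (\<phi> t p)" using charts_at_nonempty[OF N] by blast
  have id: "is_chart d" using charts_at_is_chart[OF N d] .
  have dN: "d \<in> N" and pd: "\<phi> t p \<in> dom_of d" using d by (auto simp: charts_at_iff)
  let ?G = "metric_in N g d" and ?x = "coords d \<circ> (\<lambda>s. \<phi> s p)"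
    and ?Y = "\<lambda>z. X (chart_inv d z) d"
  have xt: "?x t \<in> img_of d" using is_chart_coords_in[OF id pd] by simp
  have diff: "(\<lambda>z. ?G z a b) differentiable (at (?x t))" for a b
  proof (rule smooth_on_differentiable[OF _ xt])
    show "smooth_on (img_of d) (\<lambda>z. ?G z a b)"
      using met dN unfolding riemannian_metric_def by blast
  qed
  have dr: "((\<lambda>s. \<xi> s d) has_vector_derivative
      frechet_derivative ?Y (at (?x t)) (\<xi> t d)) (at t)" if "lie_transported N X \<phi> p \<xi>" for \<xi>
    using that d unfolding lie_transported_def by simp
  have xv: "?Y (?x t) = X (\<phi> t p) d" using is_chart_inv_coords[OF id pd] by simp
  have "((\<lambda>s. ?G (?x s) (\<eta> s d) (\<zeta> s d)) has_real_derivative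
      frechet_derivative (\<lambda>z. ?G z (\<eta> t d) (\<zeta> t d)) (at (?x t)) (X (\<phi> t p) d)
      + ?G (?x t) (frechet_derivative ?Y (at (?x t)) (\<eta> t d)) (\<zeta> t d)
      + ?G (?x t) (\<eta> t d) (frechet_derivative ?Y (at (?x t)) (\<zeta> t d))) (at t)"
    by (rule has_vector_derivative_bilinear_form_along[OF is_chart_open_img[OF id] xt
          metric_in_bilinear[OF rm dN] diff flow_curve(2)[OF N fl d] dr[OF \<eta>] dr[OF \<zeta>]])
  moreover have "frechet_derivative (\<lambda>z. ?G z (\<eta> t d) (\<zeta> t d)) (at (?x t)) (X (\<phi> t p) d)
      + ?G (?x t) (frechet_derivative ?Y (at (?x t)) (\<eta> t d)) (\<zeta> t d)
      + ?G (?x t) (\<eta> t d) (frechet_derivative ?Y (at (?x t)) (\<zeta> t d)) = 0"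
    using killing_equation[OF kf dN xt] unfolding xv .
  ultimately have 0: "((\<lambda>s. ?G (?x s) (\<eta> s d) (\<zeta> s d)) has_real_derivative 0) (at t)" by simp
  \<comment> \<open>The chart expression agrees with the metric only while the orbit stays in the
    domain of d, which is an open set of times around t.\<close>
  let ?S = "(\<lambda>s. \<phi> s p) -` dom_of d"
  have "continuous_on UNIV (\<lambda>s. \<phi> s p)"
    by (intro continuous_at_imp_continuous_on ballI flow_isCont[OF fl]) auto
  then have S: "open ?S" using is_chart_open_dom[OF id] by (simp add: open_vimage)
  show "((\<lambda>t. g (\<phi> t p) (\<eta> t) (\<zeta> t)) has_real_derivative 0) (at t)"
  proof (rule has_field_derivative_transform_within_open[OF 0 S])
    fix s assume "s \<in> ?S"
    then have ds: "d \<in> charts_at N (\<phi> s p)" using dN by (simp add: charts_at_iff)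
    have "\<eta> s \<in> tangent_space N (\<phi> s p)" "\<zeta> s \<in> tangent_space N (\<phi> s p)"
      using \<eta> \<zeta> unfolding lie_transported_def by blast+
    from metric_eq_metric_in[OF N ds this]
    show "?G (?x s) (\<eta> s d) (\<zeta> s d) = g (\<phi> s p) (\<eta> s) (\<zeta> s)" by simp
  qed (use pd in simp)
qed

text \<open>This is [X, X] = 0: the chain rule along an orbit, whose velocity is \<open>X\<close>
  itself.\<close>

lemma lie_transported_killing:
  assumes N: "smooth_manifold N" and kf: "killing_field N g X" and fl: "flow_of N X \<phi>"
  shows "lie_transported N X \<phi> p (\<lambda>t. X (\<phi> t p))"
  unfolding lie_transported_def
proof (intro allI conjI ballI)
  fix t
  show "X (\<phi> t p) \<in> tangent_space N (\<phi> t p)" by (rule killing_tangent[OF kf])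
  fix d assume d: "d \<in> charts_at N (\<phi> t p)"
  have id: "is_chart d" using charts_at_is_chart[OF N d] .
  have dN: "d \<in> N" and pd: "\<phi> t p \<in> dom_of d" using d by (auto simp: charts_at_iff)
  have "(((\<lambda>q. X q d) \<circ> chart_inv d) has_derivative
      frechet_derivative (\<lambda>z. X (chart_inv d z) d) (at (coords d (\<phi> t p)))) (at (coords d (\<phi> t p)))"
    unfolding o_def
    by (rule smooth_on_has_derivative[OF killing_smooth[OF kf dN] is_chart_coords_in[OF id pd]])
  from has_vector_derivative_along_curve[OF N d flow_curve[OF N fl d] this]
  show "((\<lambda>s. X (\<phi> s p) d) has_vector_derivative
      frechet_derivative (\<lambda>z. X (chart_inv d z) d) (at (coords d (\<phi> t p))) (X (\<phi> t p) d)) (at t)"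
    by (simp add: o_def)
qed

text \<open>Near (t, u) the lift stays in one chart c and its translate in one chart d. There the
  two-parameter map becomes a smooth map from an open set of the plane into a vector space, the
  setting in which mixed partials commute.\<close>

lemma flow_translate_in_chart:
  assumes N: "smooth_manifold N" and fl: "flow_of N X \<phi>"
    and \<gamma>: "smooth_curve N I \<gamma>" and u: "u \<in> I" and d: "d \<in> charts_at N (\<phi> t (\<gamma> u))"
  obtains U where "open U" "(t, u) \<in> U" "smooth_on U (\<lambda>(t, u). coords d (\<phi> t (\<gamma> u)))"
    "U \<subseteq> {(t, u). u \<in> I \<and> \<phi> t (\<gamma> u) \<in> dom_of d}"
proof -
  obtain c where c: "c \<in> charts_at N (\<gamma> u)" using charts_at_nonempty[OF N] by blast
  have ic: "is_chart c" and id: "is_chart d" using charts_at_is_chart[OF N] c d by blast+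
  have cN: "c \<in> N" and dN: "d \<in> N" and uc: "\<gamma> u \<in> dom_of c" and ud: "\<phi> t (\<gamma> u) \<in> dom_of d"
    using c d by (auto simp: charts_at_iff)
  have I: "open I" and contg: "continuous_on I \<gamma>" using \<gamma> by (auto simp: smooth_curve_def open_interval_def)
  define I' where "I' = I \<inter> \<gamma> -` dom_of c"
  have I': "open I'" unfolding I'_def by (rule continuous_open_preimage[OF contg I is_chart_open_dom[OF ic]])
  have x: "smooth_on I' (coords c \<circ> \<gamma>)" using \<gamma> cN unfolding smooth_curve_def I'_def by blast
  define U where "U = (UNIV \<times> I') \<inter> (\<lambda>q. \<phi> (fst q) (\<gamma> (snd q))) -` dom_of d"
  have "continuous_on (UNIV \<times> I') (\<lambda>q. \<phi> (fst q) (\<gamma> (snd q)))"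
  proof (intro continuous_at_imp_continuous_on ballI flow_isCont[OF fl])
    fix q :: "real \<times> real" assume "q \<in> UNIV \<times> I'"
    then have "isCont \<gamma> (snd q)" using contg I by (auto simp: I'_def continuous_on_eq_continuous_at)
    then show "isCont (\<lambda>q. \<gamma> (snd q)) q" by (rule isCont_o2[rotated]) (intro continuous_intros)
  qed (intro continuous_intros)
  then have U: "open U" unfolding U_def
    using I' is_chart_open_dom[OF id] by (intro continuous_open_preimage open_Times) auto
  show ?thesis
  proof (rule that[OF U])
    show "(t, u) \<in> U" using u uc ud by (simp add: U_def I'_def)
    show "U \<subseteq> {(t, u). u \<in> I \<and> \<phi> t (\<gamma> u) \<in> dom_of d}" by (auto simp: U_def I'_def)
    let ?T = "{(t, y). y \<in> img_of c \<and> \<phi> t (chart_inv c y) \<in> dom_of d}"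
    \<comment> \<open>The pair of t and the coordinates of \<gamma>(u) is written as a sum of two
      linear inclusions, so that its smoothness follows from closure under sums and bounded linear
      maps.\<close>
    let ?k = "\<lambda>q. (fst q, 0) + (0, (coords c \<circ> \<gamma>) (snd q))"
    have sx: "smooth_on U (\<lambda>q. (coords c \<circ> \<gamma>) (snd q))"
      by (rule smooth_on_compose[OF U _ x smooth_on_linear[OF U bounded_linear_snd]])
         (auto simp: U_def)
    have "smooth_on U ?k"
      by (intro smooth_on_add[OF U] smooth_on_linear[OF U]
          smooth_on_bounded_linear[OF U _ sx] bounded_linear_Pair bounded_linear_fst
          bounded_linear_zero bounded_linear_ident)
    moreover have "?k ` U \<subseteq> ?T"
      by (auto simp: U_def I'_def is_chart_inv_coords[OF ic] intro!: is_chart_coords_in[OF ic])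
    ultimately have "smooth_on U (\<lambda>q. (\<lambda>(t, y). coords d (\<phi> t (chart_inv c y))) (?k q))"
      by (intro smooth_on_compose[OF U _ flow_chart_smooth[OF fl cN dN]])
    then show "smooth_on U (\<lambda>(t, u). coords d (\<phi> t (\<gamma> u)))"
      by (rule iffD1[OF smooth_on_cong[OF U], rotated])
         (auto simp: U_def I'_def is_chart_inv_coords[OF ic])
  qed
qed

lemma flow_translate_curve:
  assumes N: "smooth_manifold N" and fl: "flow_of N X \<phi>"
    and \<gamma>: "smooth_curve N I \<gamma>" and u: "u \<in> I" and d: "d \<in> charts_at N (\<phi> t (\<gamma> u))"
  shows "isCont (\<lambda>u. \<phi> t (\<gamma> u)) u"
    and "((coords d \<circ> (\<lambda>u. \<phi> t (\<gamma> u))) has_vector_derivative velocity N (\<lambda>u. \<phi> t (\<gamma> u)) u d) (at u)"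
proof -
  obtain c where c: "c \<in> charts_at N (\<gamma> u)" using charts_at_nonempty[OF N] by blast
  show "isCont (\<lambda>u. \<phi> t (\<gamma> u)) u"
    by (rule flow_isCont[OF fl continuous_const smooth_curve_at(1)[OF \<gamma> u c]])
  obtain U where U: "open U" "(t, u) \<in> U" "smooth_on U (\<lambda>(t, u). coords d (\<phi> t (\<gamma> u)))"
    by (rule flow_translate_in_chart[OF N fl \<gamma> u d])
  have "((coords d \<circ> (\<lambda>u. \<phi> t (\<gamma> u))) has_vector_derivative
      frechet_derivative (\<lambda>(t, u). coords d (\<phi> t (\<gamma> u))) (at (t, u)) (0, 1)) (at u)"
    using has_vector_derivative_snd[OF smooth_on_has_derivative[OF U(3,2)]] by (simp add: o_def)
  then show "((coords d \<circ> (\<lambda>u. \<phi> t (\<gamma> u))) has_vector_derivative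
      velocity N (\<lambda>u. \<phi> t (\<gamma> u)) u d) (at u)"
    using velocity_component[of d N "\<lambda>u. \<phi> t (\<gamma> u)" u] d by simp
qed

text \<open>Write F for the flow translate of the curve in a chart. Its partial derivative in t is
  Y(F), since orbits are integral curves; differentiating this in u and exchanging the partials
  gives the transport equation for F_u.\<close>

lemma lie_transported_pushforward:
  assumes N: "smooth_manifold N" and kf: "killing_field N g X" and fl: "flow_of N X \<phi>"
    and \<gamma>: "smooth_curve N I \<gamma>" and u: "u \<in> I"
  shows "lie_transported N X \<phi> (\<gamma> u) (\<lambda>t. velocity N (\<lambda>u. \<phi> t (\<gamma> u)) u)"
  unfolding lie_transported_def
proof (intro allI conjI ballI)
  fix t
  show "velocity N (\<lambda>u. \<phi> t (\<gamma> u)) u \<in> tangent_space N (\<phi> t (\<gamma> u))"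
    using charts_at_nonempty[OF N, of "\<phi> t (\<gamma> u)"]
      velocity_in_tangent_space[OF N, of _ "\<lambda>u. \<phi> t (\<gamma> u)" u] flow_translate_curve[OF N fl \<gamma> u, of _ t]
    by blast
  fix d assume d: "d \<in> charts_at N (\<phi> t (\<gamma> u))"
  have id: "is_chart d" using charts_at_is_chart[OF N d] .
  have dN: "d \<in> N" and pd: "\<phi> t (\<gamma> u) \<in> dom_of d" using d by (auto simp: charts_at_iff)
  obtain U where U: "open U" "(t, u) \<in> U" "smooth_on U (\<lambda>(t, u). coords d (\<phi> t (\<gamma> u)))"
    "U \<subseteq> {(t, u). u \<in> I \<and> \<phi> t (\<gamma> u) \<in> dom_of d}"
    by (rule flow_translate_in_chart[OF N fl \<gamma> u d])
  define F where "F = (\<lambda>(t, u). coords d (\<phi> t (\<gamma> u)))"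
  define Y where "Y = (\<lambda>z. X (chart_inv d z) d)"
  define Ft where "Ft = (\<lambda>q. frechet_derivative F (at q) (1, 0))"
  define Fu where "Fu = (\<lambda>q. frechet_derivative F (at q) (0, 1))"
  have sF: "smooth_on U F" using U(3) by (simp add: F_def)
  have dU: "d \<in> charts_at N (\<phi> (fst q) (\<gamma> (snd q)))" if "q \<in> U" for q
    using that U(4) dN by (auto simp: charts_at_iff)
  \<comment> \<open>The identity is needed on all of U, not only at (t, u), because it is
    differentiated in u afterwards.\<close>
  have Ft: "Ft q = Y (F q)" if q: "q \<in> U" for q
  proof -
    obtain s w where sw: "q = (s, w)" by (cases q)
    have ds: "d \<in> charts_at N (\<phi> s (\<gamma> w))" using dU[OF q] sw by simp
    have "((\<lambda>s. F (s, w)) has_vector_derivative Ft (s, w)) (at s)"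
      unfolding Ft_def by (rule has_vector_derivative_fst[OF smooth_on_has_derivative[OF sF]]) (use q sw in simp)
    moreover have "((\<lambda>s. F (s, w)) has_vector_derivative X (\<phi> s (\<gamma> w)) d) (at s)"
      using flow_curve(2)[OF N fl ds] by (simp add: F_def o_def)
    ultimately have "Ft (s, w) = X (\<phi> s (\<gamma> w)) d" by (rule vector_derivative_unique_at)
    then show ?thesis
      using is_chart_inv_coords[OF id] ds by (simp add: sw Y_def F_def charts_at_iff)
  qed
  have Fu: "Fu (s, u) = velocity N (\<lambda>u. \<phi> s (\<gamma> u)) u d" if s: "(s, u) \<in> U" for s
  proof -
    have "((coords d \<circ> (\<lambda>u. \<phi> s (\<gamma> u))) has_vector_derivative Fu (s, u)) (at u)"
      using has_vector_derivative_snd[OF smooth_on_has_derivative[OF sF s]]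
      by (simp add: Fu_def F_def o_def)
    then show ?thesis
      using velocity_component[of d N "\<lambda>u. \<phi> s (\<gamma> u)" u] dU[OF s] by simp
  qed
  have "((\<lambda>t. Fu (t, u)) has_vector_derivative frechet_derivative Ft (at (t, u)) (0, 1)) (at t)"
    unfolding Fu_def Ft_def by (rule smooth_on_mixed_partials[OF U(1) sF U(2)])
  moreover have "frechet_derivative Ft (at (t, u)) (0, 1) =
      frechet_derivative Y (at (coords d (\<phi> t (\<gamma> u)))) (Fu (t, u))"
  proof -
    have Ftu: "coords d (\<phi> t (\<gamma> u)) = F (t, u)" by (simp add: F_def)
    have "(Y has_derivative frechet_derivative Y (at (F (t, u)))) (at (F (t, u)))"
      unfolding Y_def
      by (rule smooth_on_has_derivative[OF killing_smooth[OF kf dN]])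
         (use is_chart_coords_in[OF id pd] in \<open>simp add: F_def\<close>)
    from has_derivative_compose[OF smooth_on_has_derivative[OF sF U(2)] this]
    have "(Ft has_derivative (\<lambda>v. frechet_derivative Y (at (F (t, u)))
        (frechet_derivative F (at (t, u)) v))) (at (t, u))"
      by (rule has_derivative_transform_within_open[OF _ U(1,2)]) (simp add: Ft)
    from frechet_derivative_at[OF this, symmetric] show ?thesis by (simp add: Fu_def Ftu)
  qed
  ultimately have 1: "((\<lambda>t. Fu (t, u)) has_vector_derivative
      frechet_derivative Y (at (coords d (\<phi> t (\<gamma> u)))) (Fu (t, u))) (at t)" by simp
  have "open ((\<lambda>s. (s, u)) -` U)" by (rule open_vimage[OF U(1)]) (intro continuous_intros)
  then have "((\<lambda>s. velocity N (\<lambda>u. \<phi> s (\<gamma> u)) u d) has_vector_derivative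
      frechet_derivative Y (at (coords d (\<phi> t (\<gamma> u)))) (Fu (t, u))) (at t)"
    by (rule has_vector_derivative_transform_within_open[OF 1]) (use U(2) Fu in auto)
  then show "((\<lambda>s. velocity N (\<lambda>u. \<phi> s (\<gamma> u)) u d) has_vector_derivative
      frechet_derivative (\<lambda>z. X (chart_inv d z) d) (at (coords d (\<phi> t (\<gamma> u))))
        (velocity N (\<lambda>u. \<phi> t (\<gamma> u)) u d)) (at t)"
    by (simp add: Y_def Fu[OF U(2)])
qed

subsection \<open>Horizontal lifts and invariant surfaces\<close>

text \<open>Together with preimages a and b of the two standard basis vectors, x spans the whole
  space: the map \<open>?T\<close> is injective, hence surjective in equal dimensions. Applying L to
  \<open>?T y\<close> leaves just the coefficients of a and b, which must vanish on the
  kernel.\<close>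

lemma kernel_of_surjective_3_2:
  fixes L :: "real ^ 3 \<Rightarrow> real ^ 2"
  assumes L: "linear L" "surj L" and x: "L x = 0" "x \<noteq> 0" and z: "L z = 0"
  shows "\<exists>r. z = r *\<^sub>R x"
proof -
  obtain a b where ab: "L a = axis 1 1" "L b = axis 2 1" using L(2) by (metis surjD)
  let ?T = "\<lambda>y::real^3. y $ 1 *\<^sub>R x + y $ 2 *\<^sub>R a + y $ 3 *\<^sub>R b"
  have lT: "linear ?T" by (rule linearI) (auto simp: algebra_simps)
  have LT: "L (?T y) = vector [y $ 2, y $ 3]" for y
    using x(1) ab by (simp add: linear_add[OF L(1)] linear_cmul[OF L(1)] vec_eq_iff forall_2 axis_def)
  have zero: "y $ 2 = 0 \<and> y $ 3 = 0" if "L (?T y) = 0" for y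
    using that unfolding LT by (simp add: vec_eq_iff forall_2)
  have "inj ?T"
    unfolding linear_injective_0[OF lT]
  proof (intro allI impI)
    fix y :: "real ^ 3" assume T: "?T y = 0"
    then have "L (?T y) = 0" using linear_0[OF L(1)] by simp
    then have "y $ 2 = 0" "y $ 3 = 0" using zero by blast+
    moreover from this have "y $ 1 = 0" using T x(2) by simp
    ultimately show "y = 0" by (simp add: vec_eq_iff forall_3)
  qed
  then have "surj ?T" using linear_injective_imp_surjective[OF lT] by simp
  then obtain y where y: "z = ?T y" by (rule surjE)
  have "L (?T y) = 0" using z unfolding y .
  then have "y $ 2 = 0" "y $ 3 = 0" using zero by blast+
  then show ?thesis using y by auto
qed

text \<open>The group is abelian, so whatever fixes a translate of p already fixes p; stabilizers do
  not grow along an orbit.\<close>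

lemma flow_regular_part:
  assumes fl: "flow_of N X \<phi>" and p: "p \<in> regular_part \<phi>"
  shows "\<phi> s p \<in> regular_part \<phi>"
proof -
  have add: "\<phi> a (\<phi> b q) = \<phi> (a + b) q" for a b q using fl by (simp add: flow_of_def)
  have id: "\<phi> 0 q = q" for q using fl by (simp add: flow_of_def)
  have "stabilizer \<phi> (\<phi> s p) \<subseteq> stabilizer \<phi> p"
  proof
    fix y assume y: "y \<in> stabilizer \<phi> (\<phi> s p)"
    then obtain t where t: "y = \<phi> t" "\<phi> t (\<phi> s p) = \<phi> s p" by (auto simp: stabilizer_def)
    then have "\<phi> (- s) (\<phi> s (\<phi> t p)) = \<phi> (- s) (\<phi> s p)" by (simp add: add add.commute)
    then show "y \<in> stabilizer \<phi> p" using t by (simp add: add id stabilizer_def)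
  qed
  then show ?thesis using p unfolding regular_part_def by blast
qed

lemma velocity_const:
  "velocity A (\<lambda>_. p) t = (\<lambda>_. 0)"
  by (rule ext) (simp add: velocity_def o_def vector_derivative_const_at)

text \<open>The kernel of \<open>d\<pi>\<close> is one-dimensional and contains \<open>X\<close>, so a vector orthogonal to \<open>X\<close> is
  horizontal in the sense of the submersion.\<close>

lemma horizontal_lift_unit_speed:
  fixes N :: "('a::{t2_space, second_countable_topology}, 3) chart set"
    and Q :: "('q::{t2_space, second_countable_topology}, 2) chart set"
  assumes rm: "riemannian_manifold N g" and kf: "killing_field N g X" and fl: "flow_of N X \<phi>"
    and qm: "quotient_model N g \<phi> Q h \<pi>"
    and arc: "arc_length_param Q h I \<gamma>Q" and hl: "horizontal_lift N g X \<phi> \<pi> I \<gamma>Q \<gamma>"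
    and u: "u \<in> I" and X0: "X (\<gamma> u) \<noteq> (\<lambda>_. 0)"
  shows "g (\<gamma> u) (velocity N \<gamma> u) (velocity N \<gamma> u) = 1"
proof -
  define p where "p = \<gamma> u"
  have N: "smooth_manifold N" using rm by (simp add: riemannian_manifold_def)
  have Q: "smooth_manifold Q" using qm by (simp add: quotient_model_def riemannian_manifold_def)
  have rs: "riemannian_submersion_on N g Q h (regular_part \<phi>) \<pi>"
    and fib: "\<And>p q. p \<in> regular_part \<phi> \<Longrightarrow> q \<in> regular_part \<phi> \<Longrightarrow> \<pi> p = \<pi> q \<longleftrightarrow> q \<in> orbit \<phi> p"
    using qm unfolding quotient_model_def by blast+
  have sm: "smooth_map_on N Q (regular_part \<phi>) \<pi>" using rs by (simp add: riemannian_submersion_on_def)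
  have \<gamma>: "smooth_curve N I \<gamma>" and reg: "\<And>u. u \<in> I \<Longrightarrow> \<gamma> u \<in> regular_part \<phi>"
    and \<pi>\<gamma>: "\<And>u. u \<in> I \<Longrightarrow> \<pi> (\<gamma> u) = \<gamma>Q u"
    and orth: "g p (velocity N \<gamma> u) (X p) = 0"
    using hl u unfolding horizontal_lift_def p_def by blast+
  have I: "open I" using \<gamma> by (simp add: smooth_curve_def open_interval_def)
  have p: "p \<in> regular_part \<phi>" using reg u by (simp add: p_def)
  let ?d = "differential N Q \<pi> p"
  obtain c where c: "c \<in> charts_at N p" using charts_at_nonempty[OF N] by blast
  obtain d where d: "d \<in> charts_at Q (\<pi> p)" using charts_at_nonempty[OF Q] by blast
  define L where "L = frechet_derivative (coords d \<circ> \<pi> \<circ> chart_inv c) (at (coords c p))"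
  have L: "?d \<xi> d = L (\<xi> c)" if "\<xi> \<in> tangent_space N p" for \<xi>
    unfolding L_def by (rule differential_component[OF N sm p that c d])
  have lin: "linear L"
    unfolding L_def by (rule has_derivative_linear[OF smooth_map_on_has_derivative[OF sm p c d]])
  have onto: "?d ` tangent_space N p = tangent_space Q (\<pi> p)"
    and iso: "\<And>\<xi>. \<xi> \<in> tangent_space N p \<Longrightarrow>
      (\<And>\<zeta>. \<zeta> \<in> tangent_space N p \<Longrightarrow> ?d \<zeta> = (\<lambda>_. 0) \<Longrightarrow> g p \<xi> \<zeta> = 0) \<Longrightarrow>
      h (\<pi> p) (?d \<xi>) (?d \<xi>) = g p \<xi> \<xi>"
    using rs p unfolding riemannian_submersion_on_def Let_def by blast+
  have surj: "surj L"
  proof (rule surjI)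
    fix w
    have "coord_vec Q d (\<pi> p) w \<in> ?d ` tangent_space N p"
      unfolding onto by (rule coord_vec_in_tangent_space[OF Q d])
    then obtain \<xi> where "\<xi> \<in> tangent_space N p" "?d \<xi> = coord_vec Q d (\<pi> p) w" by auto
    then have "L (\<xi> c) = w" using L coord_vec_self[OF Q d] by metis
    then show "L (SOME v. L v = w) = w" by (rule someI)
  qed
  have XT: "X p \<in> tangent_space N p" by (rule killing_tangent[OF kf])
  \<comment> \<open>\<open>X p\<close> is the velocity of the orbit through p. The orbit stays in
    the regular part and \<pi> is constant on it, so the projected curve is constant.\<close>
  have "?d (X p) = (\<lambda>_. 0)"
  proof -
    have p0: "\<phi> 0 p = p" using fl by (simp add: flow_of_def)
    have c0: "c \<in> charts_at N (\<phi> 0 p)" "\<phi> 0 p \<in> regular_part \<phi>" using c p p0 by simp_all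
    have "velocity N (\<lambda>s. \<phi> s p) 0 = X p" using fl p0 by (simp add: flow_of_def)
    then have "?d (X p) = velocity Q (\<pi> \<circ> (\<lambda>s. \<phi> s p)) 0"
      using differential_velocity[where \<alpha> = "\<lambda>s. \<phi> s p" and t = 0, OF N sm c0(2,1) flow_curve[OF N fl c0(1)]] p0
      by simp
    moreover have "\<pi> \<circ> (\<lambda>s. \<phi> s p) = (\<lambda>_. \<pi> p)"
    proof
      fix s
      have "\<phi> s p \<in> orbit \<phi> p" unfolding orbit_def by blast
      then show "(\<pi> \<circ> (\<lambda>s. \<phi> s p)) s = \<pi> p" using fib[OF p flow_regular_part[OF fl p], of s] by simp
    qed
    ultimately show ?thesis by (simp add: velocity_const)
  qed
  then have LX: "L (X p c) = 0" using L[OF XT] by simp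
  have Xc: "X p c \<noteq> 0"
    using tangent_space_eqI[OF XT tangent_space_zero[OF N] c] X0 by (auto simp: p_def)
  have vT: "velocity N \<gamma> u \<in> tangent_space N p"
    unfolding p_def by (rule smooth_curve_velocity[OF N \<gamma> u])
  have "h (\<pi> p) (?d (velocity N \<gamma> u)) (?d (velocity N \<gamma> u)) = g p (velocity N \<gamma> u) (velocity N \<gamma> u)"
  proof (rule iso[OF vT])
    fix \<zeta> assume \<zeta>: "\<zeta> \<in> tangent_space N p" "?d \<zeta> = (\<lambda>_. 0)"
    then have "L (\<zeta> c) = 0" using L by metis
    then obtain r where r: "\<zeta> c = r *\<^sub>R X p c"
      using kernel_of_surjective_3_2[OF lin surj LX Xc] by blast
    note zT = tangent_space_zero[OF N]
    have rX: "(\<lambda>e. r *\<^sub>R X p e + 0) \<in> tangent_space N p" by (rule tangent_space_lincomb[OF N XT zT])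
    have "\<zeta> = (\<lambda>e. r *\<^sub>R X p e + 0)" by (rule tangent_space_eqI[OF \<zeta>(1) rX c]) (simp add: r)
    then have "g p \<zeta> (velocity N \<gamma> u) = r * g p (X p) (velocity N \<gamma> u) + g p (\<lambda>_. 0) (velocity N \<gamma> u)"
      using metric_lincomb[OF rm XT zT vT] by simp
    also have "\<dots> = 0"
      using metric_zero[OF rm vT] metric_commute[OF rm XT vT] orth by simp
    finally show "g p (velocity N \<gamma> u) \<zeta> = 0" using metric_commute[OF rm vT \<zeta>(1)] by simp
  qed
  moreover have "?d (velocity N \<gamma> u) = velocity Q \<gamma>Q u"
  proof -
    have cu: "c \<in> charts_at N (\<gamma> u)" "\<gamma> u \<in> regular_part \<phi>" using c reg u by (simp_all add: p_def)
    have "?d (velocity N \<gamma> u) = velocity Q (\<pi> \<circ> \<gamma>) u"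
      unfolding p_def by (rule differential_velocity[OF N sm cu(2,1) smooth_curve_at[OF \<gamma> u cu(1)]])
    also have "\<dots> = velocity Q \<gamma>Q u" by (rule velocity_cong[OF I u]) (simp add: \<pi>\<gamma>)
    finally show ?thesis .
  qed
  moreover have "h (\<pi> p) (velocity Q \<gamma>Q u) (velocity Q \<gamma>Q u) = 1"
    using arc u \<pi>\<gamma>[OF u] unfolding arc_length_param_def tnorm_def p_def by simp
  ultimately show ?thesis by (simp add: p_def)
qed

text \<open>In a chart the function is a finite sum of products of components of \<open>X\<close>
  and metric coefficients, composed with the curve. It provides the two derivatives that the
  curvature formula takes; smoothness near each u is enough, as the curve may leave any single
  chart.\<close>

lemma metric_killing_along_curve_smooth:
  assumes rm: "riemannian_manifold N g" and kf: "killing_field N g X" and \<gamma>: "smooth_curve N I \<gamma>"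
    and u: "u \<in> I"
  shows "\<exists>S. open S \<and> u \<in> S \<and> smooth_on S (\<lambda>u. g (\<gamma> u) (X (\<gamma> u)) (X (\<gamma> u)))"
proof -
  have N: "smooth_manifold N" and met: "riemannian_metric N g"
    using rm by (auto simp: riemannian_manifold_def)
  obtain c where c: "c \<in> charts_at N (\<gamma> u)" using charts_at_nonempty[OF N] by blast
  have ic: "is_chart c" using charts_at_is_chart[OF N c] .
  have cN: "c \<in> N" and uc: "\<gamma> u \<in> dom_of c" using c by (auto simp: charts_at_iff)
  define S where "S = I \<inter> \<gamma> -` dom_of c"
  have "open I" "continuous_on I \<gamma>" using \<gamma> by (auto simp: smooth_curve_def open_interval_def)
  then have S: "open S" unfolding S_def by (intro continuous_open_preimage is_chart_open_dom[OF ic])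
  let ?Y = "\<lambda>z. X (chart_inv c z) c"
  let ?P = "\<lambda>z. \<Sum>i\<in>Basis. \<Sum>j\<in>Basis. (?Y z \<bullet> i) *\<^sub>R (?Y z \<bullet> j) *\<^sub>R metric_in N g c z i j"
  note R = is_chart_open_img[OF ic] and Y = killing_smooth[OF kf cN]
  have "smooth_on (img_of c) (\<lambda>z. metric_in N g c z i j)" for i j
    using met cN unfolding riemannian_metric_def by blast
  then have P: "smooth_on (img_of c) ?P"
    by (intro smooth_on_sum[OF R] smooth_on_scaleR[OF R] smooth_on_bounded_linear[OF R _ Y]
        bounded_linear_inner_left)
  have x: "smooth_on S (coords c \<circ> \<gamma>)" using \<gamma> cN unfolding smooth_curve_def S_def by blast
  have "smooth_on S (\<lambda>u. ?P ((coords c \<circ> \<gamma>) u))"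
    by (rule smooth_on_compose[OF S _ P x]) (auto simp: S_def is_chart_coords_in[OF ic])
  moreover have "?P ((coords c \<circ> \<gamma>) u) = g (\<gamma> u) (X (\<gamma> u)) (X (\<gamma> u))" if "u \<in> S" for u
  proof -
    have cu: "c \<in> charts_at N (\<gamma> u)" and uc: "\<gamma> u \<in> dom_of c"
      using that cN by (auto simp: S_def charts_at_iff)
    note T = killing_tangent[OF kf, of "\<gamma> u"]
    have "g (\<gamma> u) (X (\<gamma> u)) (X (\<gamma> u)) =
        metric_in N g c (coords c (\<gamma> u)) (X (\<gamma> u) c) (X (\<gamma> u) c)"
      by (rule metric_eq_metric_in[OF N cu T T])
    also have "\<dots> = ?P (coords c (\<gamma> u))"
      unfolding bilinear_euclidean_expansion[OF metric_in_bilinear[OF rm cN is_chart_coords_in[OF ic uc]],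
          of "X (\<gamma> u) c"]
      by (simp add: is_chart_inv_coords[OF ic uc] mult.assoc)
    finally show ?thesis by simp
  qed
  ultimately have "smooth_on S (\<lambda>u. g (\<gamma> u) (X (\<gamma> u)) (X (\<gamma> u)))"
    using smooth_on_cong[OF S] by (metis (no_types, lifting))
  then show ?thesis using S u uc by (auto simp: S_def)
qed

section \<open>The surface in the coordinates of its parametrization\<close>

lemma has_vector_derivative_vector_2:
  "((\<lambda>s. vector [s, b] :: real ^ 2) has_vector_derivative axis 1 1) (at t)"
  "((\<lambda>s. vector [b, s] :: real ^ 2) has_vector_derivative axis 2 1) (at t)"
proof -
  have "(\<lambda>s. vector [s, b] :: real ^ 2) = (\<lambda>s. s *\<^sub>R axis 1 1 + b *\<^sub>R axis 2 1)"
    "(\<lambda>s. vector [b, s] :: real ^ 2) = (\<lambda>s. s *\<^sub>R axis 2 1 + b *\<^sub>R axis 1 1)"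
    by (auto simp: vec_eq_iff forall_2 axis_def)
  then show "((\<lambda>s. vector [s, b] :: real ^ 2) has_vector_derivative axis 1 1) (at t)"
    "((\<lambda>s. vector [b, s] :: real ^ 2) has_vector_derivative axis 2 1) (at t)"
    by (auto simp: has_vector_derivative_def intro!: derivative_eq_intros)
qed

text \<open>The coordinate vectors of \<kappa> are the velocities of its coordinate lines. The
  immersion sends these lines to a translate of the lift and to a piece of an orbit, whose
  velocities are the right-hand sides.\<close>

lemma parametrized_surface_differential:
  assumes N: "smooth_manifold N" and fl: "flow_of N X \<phi>" and M: "smooth_manifold M"
    and f: "smooth_map_on M N UNIV f" and lp: "local_parametrization M f \<phi> I \<gamma> J \<kappa>"
    and u: "u \<in> I" and v: "v \<in> J"
  defines "p \<equiv> chart_inv \<kappa> (vector [u, v])"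
  shows "differential M N f p (coord_vec M \<kappa> p (axis 1 1)) = velocity N (\<lambda>u. \<phi> v (\<gamma> u)) u"
    and "differential M N f p (coord_vec M \<kappa> p (axis 2 1)) = X (\<phi> v (\<gamma> u))"
    and "f p = \<phi> v (\<gamma> u)" and "\<kappa> \<in> charts_at M p"
proof -
  have I: "open I" and J: "open J" and \<kappa>: "\<kappa> \<in> M"
    and img: "img_of \<kappa> = {y. y $ 1 \<in> I \<and> y $ 2 \<in> J}"
    and par: "\<And>u v. u \<in> I \<Longrightarrow> v \<in> J \<Longrightarrow> f (chart_inv \<kappa> (vector [u, v])) = \<phi> v (\<gamma> u)"
    using lp by (auto simp: local_parametrization_def open_interval_def)
  show "f p = \<phi> v (\<gamma> u)" using par u v by (simp add: p_def)
  have imgu: "\<And>s. s \<in> I \<Longrightarrow> vector [s, v] \<in> img_of \<kappa>" and imgv: "\<And>s. s \<in> J \<Longrightarrow> vector [u, s] \<in> img_of \<kappa>"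
    using u v by (simp_all add: img)
  note cu = chart_curve[OF M \<kappa> I u imgu has_vector_derivative_vector_2(1)]
    and cv = chart_curve[OF M \<kappa> J v imgv has_vector_derivative_vector_2(2)]
  show "\<kappa> \<in> charts_at M p" using cu(3) by (simp add: p_def)
  have "coord_vec M \<kappa> p (axis 1 1) = velocity M (\<lambda>s. chart_inv \<kappa> (vector [s, v])) u"
    unfolding p_def by (rule velocity_eq_coord_vec[where t = u, OF M cu(3,1,2), symmetric])
  then have "differential M N f p (coord_vec M \<kappa> p (axis 1 1)) =
      velocity N (f \<circ> (\<lambda>s. chart_inv \<kappa> (vector [s, v]))) u"
    using differential_velocity[where t = u, OF M f UNIV_I cu(3,1,2)] by (simp add: p_def)
  also have "\<dots> = velocity N (\<lambda>u. \<phi> v (\<gamma> u)) u"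
    by (rule velocity_cong[OF I u]) (simp add: par v)
  finally show "differential M N f p (coord_vec M \<kappa> p (axis 1 1)) = velocity N (\<lambda>u. \<phi> v (\<gamma> u)) u" .
  have "coord_vec M \<kappa> p (axis 2 1) = velocity M (\<lambda>s. chart_inv \<kappa> (vector [u, s])) v"
    unfolding p_def by (rule velocity_eq_coord_vec[where t = v, OF M cv(3,1,2), symmetric])
  then have "differential M N f p (coord_vec M \<kappa> p (axis 2 1)) =
      velocity N (f \<circ> (\<lambda>s. chart_inv \<kappa> (vector [u, s]))) v"
    using differential_velocity[where t = v, OF M f UNIV_I cv(3,1,2)] by (simp add: p_def)
  also have "\<dots> = velocity N (\<lambda>s. \<phi> s (\<gamma> u)) v"
    by (rule velocity_cong[OF J v]) (simp add: par u)
  also have "\<dots> = X (\<phi> v (\<gamma> u))" using fl by (simp add: flow_of_def)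
  finally show "differential M N f p (coord_vec M \<kappa> p (axis 2 1)) = X (\<phi> v (\<gamma> u))" .
qed

text \<open>\<open>X\<close> is the image of a nonzero coordinate vector under an injective
  differential, but only at times v in J. Since J may omit 0, positivity is carried back to time 0
  by the constancy of g(X, X) along the orbit.\<close>

lemma killing_nonzero_on_surface:
  assumes rm: "riemannian_manifold N g" and kf: "killing_field N g X" and fl: "flow_of N X \<phi>"
    and M: "smooth_manifold M" and imm: "immersion M N f"
    and lp: "local_parametrization M f \<phi> I \<gamma> J \<kappa>" and u: "u \<in> I"
  shows "g (\<gamma> u) (X (\<gamma> u)) (X (\<gamma> u)) > 0"
proof -
  have N: "smooth_manifold N" using rm by (simp add: riemannian_manifold_def)
  have f: "smooth_map_on M N UNIV f"
    and inj: "\<And>p. inj_on (differential M N f p) (tangent_space M p)"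
    using imm by (simp_all add: immersion_def)
  obtain v where v: "v \<in> J" using lp by (auto simp: local_parametrization_def open_interval_def)
  let ?p = "chart_inv \<kappa> (vector [u, v])"
  note S = parametrized_surface_differential[OF N fl M f lp u v]
  have "coord_vec M \<kappa> ?p (axis 2 1) \<noteq> (\<lambda>_. 0)"
    using coord_vec_self[OF M S(4), of "axis 2 1"] by (metis axis_eq_0_iff zero_neq_one)
  then have "differential M N f ?p (coord_vec M \<kappa> ?p (axis 2 1)) \<noteq> differential M N f ?p (\<lambda>_. 0)"
    using inj_onD[OF inj _ coord_vec_in_tangent_space[OF M S(4)] tangent_space_zero[OF M]] by blast
  then have "X (\<phi> v (\<gamma> u)) \<noteq> (\<lambda>_. 0)"
    unfolding S(2) differential_zero[OF M f UNIV_I] .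
  then have "g (\<phi> v (\<gamma> u)) (X (\<phi> v (\<gamma> u))) (X (\<phi> v (\<gamma> u))) > 0"
    using metric_pos[OF rm killing_tangent[OF kf] killing_tangent[OF kf]] by blast
  moreover note lie = lie_transported_killing[OF N kf fl, of "\<gamma> u"]
  ultimately have "g (\<phi> 0 (\<gamma> u)) (X (\<phi> 0 (\<gamma> u))) (X (\<phi> 0 (\<gamma> u))) > 0"
    using metric_lie_transported_constant[OF rm kf fl lie lie, of v 0] by simp
  then show ?thesis using fl by (simp add: flow_of_def)
qed

section \<open>The induced metric, its flatness, and the loxodrome equations\<close>

theorem proposition6p3:
  fixes N :: "('a::{t2_space, second_countable_topology}, 3) chart set"
    and g :: "('a, 3) metric"
    and X :: "'a \<Rightarrow> ('a, 3) tvec"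
    and \<phi> :: "real \<Rightarrow> 'a \<Rightarrow> 'a"
    and Q :: "('q::{t2_space, second_countable_topology}, 2) chart set"
    and h :: "('q, 2) metric"
    and \<pi> :: "'a \<Rightarrow> 'q"
    and M :: "('b::{t2_space, second_countable_topology}, 2) chart set"
    and f :: "'b \<Rightarrow> 'a"
    and I J K :: "real set"
    and \<gamma>Q :: "real \<Rightarrow> 'q" and \<gamma> :: "real \<Rightarrow> 'a"
    and \<kappa> :: "('b, 2) chart"
    and \<omega> :: "real \<Rightarrow> real"
    and \<alpha> :: "real \<Rightarrow> 'b"
    and \<theta>\<^sub>0 s\<^sub>0 :: real
  assumes "riemannian_manifold N g"
    and "killing_field N g X"
    and "flow_of N X \<phi>"
    and "quotient_model N g \<phi> Q h \<pi>"
    and "invariant_surface N \<phi> M f"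
    and "flat M (induced_metric M N g f)"
    and "smooth_curve Q I \<gamma>Q"
    and "arc_length_param Q h I \<gamma>Q"
    and "horizontal_lift N g X \<phi> \<pi> I \<gamma>Q \<gamma>"
    and "local_parametrization M f \<phi> I \<gamma> J \<kappa>"
    and "\<omega> = (\<lambda>u. tnorm g (\<gamma> u) (X (\<gamma> u)))"
    and "0 < \<theta>\<^sub>0" and "\<theta>\<^sub>0 < pi"
    and "loxodrome N g X M f \<theta>\<^sub>0 K \<alpha>"
    and "s\<^sub>0 \<in> K" and "\<alpha> s\<^sub>0 \<in> dom_of \<kappa>"
  shows "\<exists>a. (\<forall>u\<in>I. (\<omega> has_real_derivative a) (at u)) \<and>
             (a \<noteq> 0 \<longrightarrow>
                (\<exists>\<sigma>\<in>{1, -1}. \<exists>b.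
                   locally_graph \<kappa> K \<alpha> s\<^sub>0 (\<lambda>u. \<sigma> * (cot \<theta>\<^sub>0 / a) * ln (\<omega> u) + b))) \<and>
             (a = 0 \<longrightarrow>
                (\<exists>c. (\<forall>u\<in>I. \<omega> u = c) \<and>
                   (\<exists>\<sigma>\<in>{1, -1}. \<exists>b.
                      locally_graph \<kappa> K \<alpha> s\<^sub>0 (\<lambda>u. \<sigma> * (cot \<theta>\<^sub>0 / c) * u + b))))"
proof -
  note rm = assms(1) and kf = assms(2) and fl = assms(3) and lp = assms(10)
  have N: "smooth_manifold N" using rm by (simp add: riemannian_manifold_def)
  have M: "smooth_manifold M" and imm: "immersion M N f"
    using assms(5) by (simp_all add: invariant_surface_def)
  have f: "smooth_map_on M N UNIV f" using imm by (simp add: immersion_def)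
  have \<gamma>: "smooth_curve N I \<gamma>" using assms(9) by (simp add: horizontal_lift_def)
  have I: "open_interval I" and J: "open_interval J" and \<kappa>: "\<kappa> \<in> M"
    and img: "img_of \<kappa> = {y. y $ 1 \<in> I \<and> y $ 2 \<in> J}"
    using lp by (auto simp: local_parametrization_def)
  have i\<kappa>: "is_chart \<kappa>" by (rule smooth_manifold_is_chart[OF M \<kappa>])
  define E where "E = (\<lambda>u. g (\<gamma> u) (X (\<gamma> u)) (X (\<gamma> u)))"
  have \<omega>: "\<omega> = (\<lambda>u. sqrt (E u))" by (simp add: assms(11) E_def tnorm_def)
  have Epos: "E u > 0" if "u \<in> I" for u
    unfolding E_def by (rule killing_nonzero_on_surface[OF rm kf fl M imm lp that])
  \<comment> \<open>\<open>T\<close> and \<open>Z\<close> are the two partial derivatives of the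
    parametrization, viewed for fixed u as fields along the orbit of \<gamma>(u) with v as
    time.\<close>
  define T where "T = (\<lambda>u v. velocity N (\<lambda>u. \<phi> v (\<gamma> u)) u)"
  define Z where "Z = (\<lambda>u v. X (\<phi> v (\<gamma> u)))"
  have \<phi>0: "\<phi> 0 q = q" for q using fl by (simp add: flow_of_def)
  have ltT: "lie_transported N X \<phi> (\<gamma> u) (T u)" if "u \<in> I" for u
    unfolding T_def by (rule lie_transported_pushforward[OF N kf fl \<gamma> that])
  have ltZ: "lie_transported N X \<phi> (\<gamma> u) (Z u)" for u
    unfolding Z_def by (rule lie_transported_killing[OF N kf fl])
  have TT: "g (\<phi> v (\<gamma> u)) (T u v) (T u v) = 1" if u: "u \<in> I" for u v
  proof -
    have "X (\<gamma> u) \<noteq> (\<lambda>_. 0)"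
      using Epos[OF u] metric_zero[OF rm tangent_space_zero[OF N], of "\<gamma> u"] by (auto simp: E_def)
    from horizontal_lift_unit_speed[OF rm kf fl assms(4,8,9) u this] show ?thesis
      using metric_lie_transported_constant[OF rm kf fl ltT[OF u] ltT[OF u], of v 0]
      by (simp add: T_def \<phi>0)
  qed
  have TZ: "g (\<phi> v (\<gamma> u)) (T u v) (Z u v) = 0" if u: "u \<in> I" for u v
    using metric_lie_transported_constant[OF rm kf fl ltT[OF u] ltZ, of v 0] assms(9) u
    by (simp add: T_def Z_def \<phi>0 horizontal_lift_def)
  have ZZ: "g (\<phi> v (\<gamma> u)) (Z u v) (Z u v) = E u" for u v
    using metric_lie_transported_constant[OF rm kf fl ltZ ltZ, of v u 0] by (simp add: Z_def E_def \<phi>0)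
  have TZtan: "T u v \<in> tangent_space N (\<phi> v (\<gamma> u))" "Z u v \<in> tangent_space N (\<phi> v (\<gamma> u))"
    if "u \<in> I" for u v
    using ltT[OF that] ltZ[of u] unfolding lie_transported_def by blast+
  have ZT: "g (\<phi> v (\<gamma> u)) (Z u v) (T u v) = 0" if u: "u \<in> I" for u v
    using TZ[OF u] metric_commute[OF rm TZtan[OF u]] by metis

  define H where "H = (\<lambda>z. \<chi> i j. metric_in M (induced_metric M N g f) \<kappa> z (axis i 1) (axis j 1))"
  have H: "H z = vector [vector [1, 0], vector [0, E (z $ 1)]]" if z: "z \<in> img_of \<kappa>" for z
  proof -
    have uv: "z $ 1 \<in> I" "z $ 2 \<in> J" using z by (simp_all add: img)
    note S = parametrized_surface_differential[OF N fl M f lp uv]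
    have zz: "vector [z $ 1, z $ 2] = z" by (simp add: vec_eq_iff forall_2)
    let ?p = "chart_inv \<kappa> z"
    have "differential M N f ?p (coord_vec M \<kappa> ?p (axis 1 1)) = T (z $ 1) (z $ 2)"
      "differential M N f ?p (coord_vec M \<kappa> ?p (axis 2 1)) = Z (z $ 1) (z $ 2)"
      "f ?p = \<phi> (z $ 2) (\<gamma> (z $ 1))"
      using S(1-3) unfolding zz T_def Z_def by blast+
    then show ?thesis
      unfolding H_def metric_in_def induced_metric_def vec_eq_iff forall_2
      by (simp add: TT[OF uv(1)] TZ[OF uv(1)] ZT[OF uv(1)] ZZ)
  qed
  define E1 where "E1 = (\<lambda>u. frechet_derivative E (at u) 1)"
  define E2 where "E2 = (\<lambda>u. frechet_derivative E1 (at u) 1)"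
  have E12: "(E has_real_derivative E1 u) (at u)" "(E1 has_real_derivative E2 u) (at u)" if u: "u \<in> I" for u
  proof -
    obtain S where S: "u \<in> S" "smooth_on S E"
      using metric_killing_along_curve_smooth[OF rm kf \<gamma> u] unfolding E_def by blast
    show "(E has_real_derivative E1 u) (at u)"
      unfolding E1_def by (rule smooth_on_has_real_derivative[OF S(2,1)])
    have "smooth_on S E1" unfolding E1_def by (rule smooth_on_frechet_derivative[OF S(2)])
    then show "(E1 has_real_derivative E2 u) (at u)"
      unfolding E2_def by (rule smooth_on_has_real_derivative[OF _ S(1)])
  qed
  have "((E1 u)\<^sup>2 / (4 * E u) - E2 u / 2) / E u = 0" if u: "u \<in> I" for u
  proof -
    \<comment> \<open>The coefficients depend on u alone, so any v in the nonempty interval J gives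
      a point of the chart at which flatness can be evaluated.\<close>
    obtain v where v: "v \<in> J" using J by (auto simp: open_interval_def)
    define y :: "real ^ 2" where "y = vector [u, v]"
    have y: "y \<in> img_of \<kappa>" using u v by (simp add: img y_def)
    have "gauss_curvature_in H y = 0" using assms(6) \<kappa> y unfolding flat_def H_def by blast
    moreover have "gauss_curvature_in H y = ((E1 (y $ 1))\<^sup>2 / (4 * E (y $ 1)) - E2 (y $ 1) / 2) / E (y $ 1)"
      by (rule gauss_curvature_in_warped[where E = E and ?E1.0 = E1 and ?E2.0 = E2,
            OF is_chart_open_img[OF i\<kappa>] H _ _ _ y])
         (auto simp: img Epos E12)
    ultimately show ?thesis by (simp add: y_def)
  qed
  then obtain a where a: "\<And>u. u \<in> I \<Longrightarrow> (\<omega> has_real_derivative a) (at u)"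
    using sqrt_affine_of_curvature_zero[OF I Epos E12] unfolding \<omega> by blast
  have \<omega>pos: "\<omega> u > 0" if "u \<in> I" for u using Epos[OF that] by (simp add: \<omega>)

  have \<alpha>: "smooth_curve M K \<alpha>"
    and al: "\<And>s. s \<in> K \<Longrightarrow> tnorm (induced_metric M N g f) (\<alpha> s) (velocity M \<alpha> s) = 1"
    and ang: "\<And>s. s \<in> K \<Longrightarrow> g (f (\<alpha> s)) (differential M N f (\<alpha> s) (velocity M \<alpha> s)) (X (f (\<alpha> s)))
                  = tnorm g (f (\<alpha> s)) (X (f (\<alpha> s))) * cos \<theta>\<^sub>0"
    using assms(14) by (simp_all add: loxodrome_def arc_length_param_def)
  \<comment> \<open>The curve may leave the coordinate domain, so everything is restricted to a ball
    around s0 on which it stays inside. This ball is the interval that witnesses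
    \<open>locally_graph\<close>.\<close>
  define K' where "K' = K \<inter> \<alpha> -` dom_of \<kappa>"
  have "open K'" unfolding K'_def
    using \<alpha> is_chart_open_dom[OF i\<kappa>]
    by (intro continuous_open_preimage) (auto simp: smooth_curve_def open_interval_def)
  moreover have "s\<^sub>0 \<in> K'" using assms(15,16) by (simp add: K'_def)
  ultimately obtain e where e: "e > 0" "ball s\<^sub>0 e \<subseteq> K'" using open_contains_ball by blast
  define K0 where "K0 = ball s\<^sub>0 e"
  have K0: "open_interval K0" "s\<^sub>0 \<in> K0" "K0 \<subseteq> K"
    using e by (auto simp: K0_def K'_def open_interval_def is_interval_ball_real)
  have oK0: "open K0" by (simp add: K0_def)
  have sx: "smooth_on K0 (coords \<kappa> \<circ> \<alpha>)"
    using \<alpha> \<kappa> e smooth_on_subset unfolding smooth_curve_def K0_def K'_def by blast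
  define U where "U = (\<lambda>s. (coords \<kappa> \<circ> \<alpha>) s $ 1)"
  define V where "V = (\<lambda>s. (coords \<kappa> \<circ> \<alpha>) s $ 2)"
  have sU: "smooth_on K0 U" and sV: "smooth_on K0 V"
    unfolding U_def V_def by (intro smooth_on_bounded_linear[OF oK0 bounded_linear_vec_nth sx])+
  define U' where "U' = (\<lambda>s. frechet_derivative U (at s) 1)"
  define V' where "V' = (\<lambda>s. frechet_derivative V (at s) 1)"
  have U': "(U has_real_derivative U' s) (at s)" and V': "(V has_real_derivative V' s) (at s)"
    if "s \<in> K0" for s
    unfolding U'_def V'_def using smooth_on_has_real_derivative[OF _ that] sU sV by blast+
  have cU': "continuous_on K0 U'"
    unfolding U'_def by (rule smooth_on_continuous[OF smooth_on_frechet_derivative[OF sU]])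
  have in_dom: "\<alpha> s \<in> dom_of \<kappa>" if "s \<in> K0" for s using that e by (auto simp: K0_def K'_def)
  have UV: "vector [U s, V s] \<in> img_of \<kappa>" "\<alpha> s = chart_inv \<kappa> (vector [U s, V s])" if s: "s \<in> K0" for s
  proof -
    have "vector [U s, V s] = coords \<kappa> (\<alpha> s)" by (simp add: U_def V_def vec_eq_iff forall_2)
    then show "vector [U s, V s] \<in> img_of \<kappa>" "\<alpha> s = chart_inv \<kappa> (vector [U s, V s])"
      using is_chart_coords_in[OF i\<kappa> in_dom[OF s]] is_chart_inv_coords[OF i\<kappa> in_dom[OF s]] by simp_all
  qed
  have UI: "U s \<in> I" and VJ: "V s \<in> J" if "s \<in> K0" for s using UV(1)[OF that] by (simp_all add: img)
  \<comment> \<open>Unit speed and constant angle in terms of E. Pairing with \<open>X\<close>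
    produces E = \<omega>^2 on the left and only \<omega> on the right; dividing by \<omega> > 0
    later gives the planar form.\<close>
  have lox: "(U' s)\<^sup>2 + (V' s)\<^sup>2 * E (U s) = 1" "V' s * E (U s) = \<omega> (U s) * cos \<theta>\<^sub>0" if s: "s \<in> K0" for s
  proof -
    note S = parametrized_surface_differential[OF N fl M f lp UI[OF s] VJ[OF s], folded UV(2)[OF s]]
    let ?p = "\<alpha> s"
    have sK: "s \<in> K" using s K0 by blast
    have vT: "velocity M \<alpha> s \<in> tangent_space M ?p" by (rule smooth_curve_velocity[OF M \<alpha> sK])
    have comp: "velocity M \<alpha> s \<kappa> = U' s *\<^sub>R axis 1 1 + V' s *\<^sub>R axis 2 1"
    proof -
      note d = smooth_curve_at(2)[OF \<alpha> sK S(4)]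
      have "((\<lambda>s. (coords \<kappa> \<circ> \<alpha>) s $ i) has_vector_derivative velocity M \<alpha> s \<kappa> $ i) (at s)" for i
        by (rule bounded_linear.has_vector_derivative[OF bounded_linear_vec_nth d])
      from this[of 1] this[of 2]
      have "velocity M \<alpha> s \<kappa> $ 1 = U' s" "velocity M \<alpha> s \<kappa> $ 2 = V' s"
        using U'[OF s] V'[OF s] vector_derivative_unique_at
        unfolding U_def V_def has_real_derivative_iff_has_vector_derivative by blast+
      then show ?thesis by (simp add: vec_eq_iff forall_2 axis_def)
    qed
    note cT = coord_vec_in_tangent_space[OF M S(4)]
    let ?c1 = "coord_vec M \<kappa> ?p (axis 1 1)" and ?c2 = "coord_vec M \<kappa> ?p (axis 2 1)"
    \<comment> \<open>The summand 0 gives the multiple of \<open>?c2\<close> the shape of a linear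
      combination, as the linearity lemmas expect.\<close>
    have c2: "(\<lambda>c. V' s *\<^sub>R ?c2 c + 0) \<in> tangent_space M ?p"
      by (rule tangent_space_lincomb[OF M cT tangent_space_zero[OF M]])
    have "velocity M \<alpha> s = (\<lambda>c. U' s *\<^sub>R ?c1 c + (V' s *\<^sub>R ?c2 c + 0))"
      by (rule tangent_space_eqI[OF vT tangent_space_lincomb[OF M cT c2] S(4)])
         (simp add: comp coord_vec_self[OF M S(4)])
    then have "differential M N f ?p (velocity M \<alpha> s) =
        (\<lambda>d. U' s *\<^sub>R T (U s) (V s) d + V' s *\<^sub>R Z (U s) (V s) d)"
      using differential_lincomb[OF M f UNIV_I cT c2, of "U' s"]
        differential_lincomb[OF M f UNIV_I cT tangent_space_zero[OF M], of "V' s"]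
      by (simp add: S(1,2) T_def Z_def differential_zero[OF M f UNIV_I])
    note dv = this
    note tan = TZtan[OF UI[OF s], of "V s"]
    have "g (f ?p) (differential M N f ?p (velocity M \<alpha> s)) (differential M N f ?p (velocity M \<alpha> s)) = 1"
      using al[OF sK] by (simp add: tnorm_def induced_metric_def)
    then show "(U' s)\<^sup>2 + (V' s)\<^sup>2 * E (U s) = 1"
      unfolding dv S(3) metric_square_lincomb2[OF rm tan] by (simp add: TT TZ ZZ UI[OF s])
    have "g (f ?p) (differential M N f ?p (velocity M \<alpha> s)) (Z (U s) (V s)) = sqrt (E (U s)) * cos \<theta>\<^sub>0"
      using ang[OF sK] ZZ[of "V s" "U s"] by (simp add: tnorm_def S(3) Z_def)
    then show "V' s * E (U s) = \<omega> (U s) * cos \<theta>\<^sub>0"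
      unfolding dv S(3) metric_lincomb2[OF rm tan tan(2)] by (simp add: TZ ZZ UI[OF s] \<omega>)
  qed
  have EU: "E (U s) = \<omega> (U s) * \<omega> (U s)" if "s \<in> K0" for s
    using Epos[OF UI[OF that]] by (simp add: \<omega>)
  have angle: "\<omega> (U s) * V' s = cos \<theta>\<^sub>0" if s: "s \<in> K0" for s
  proof -
    have "\<omega> (U s) * (\<omega> (U s) * V' s) = \<omega> (U s) * cos \<theta>\<^sub>0"
      using lox(2)[OF s] EU[OF s] by (simp add: ac_simps)
    then show ?thesis using \<omega>pos[OF UI[OF s]] by simp
  qed
  have speed: "(U' s)\<^sup>2 = (sin \<theta>\<^sub>0)\<^sup>2" if s: "s \<in> K0" for s
  proof -
    have "(V' s)\<^sup>2 * E (U s) = (\<omega> (U s) * V' s)\<^sup>2"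
      unfolding EU[OF s] by (simp add: power2_eq_square ac_simps)
    then show ?thesis using lox(1)[OF s] angle[OF s] by (simp add: sin_squared_eq)
  qed
  \<comment> \<open>The cases a = 0 and a nonzero differ only in the antiderivative P of cot
    \<theta> / \<omega>; here the local graph is obtained for any such P, with U as the change of
    parameter.\<close>
  have graph: "\<exists>\<sigma>\<in>{1, -1}. \<exists>b. locally_graph \<kappa> K \<alpha> s\<^sub>0 (\<lambda>u. \<sigma> * P u + b)"
    if P: "\<And>u. u \<in> I \<Longrightarrow> (P has_real_derivative cot \<theta>\<^sub>0 / \<omega> u) (at u)" for P
  proof -
    note pl = planar_loxodrome[OF K0(1) assms(12,13) U' cU' V' speed angle \<omega>pos[OF UI] P[OF UI]]
    obtain \<sigma> b where \<sigma>: "\<sigma> \<in> {1, -1}" and b: "\<And>s. s \<in> K0 \<Longrightarrow> V s = \<sigma> * P (U s) + b"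
      using pl(2) by blast
    have "deriv U s \<noteq> 0" if "s \<in> K0" for s
      using speed[OF that] sin_gt_zero[OF assms(12,13)] DERIV_imp_deriv[OF U'[OF that]] by auto
    then have "locally_graph \<kappa> K \<alpha> s\<^sub>0 (\<lambda>u. \<sigma> * P u + b)"
      unfolding locally_graph_def using K0 sU pl(1) UV b by (intro exI[of _ K0] exI[of _ U]) simp
    then show ?thesis using \<sigma> by blast
  qed
  show ?thesis
  proof (rule exI[of _ a], intro conjI impI)
    show "\<forall>u\<in>I. (\<omega> has_real_derivative a) (at u)" using a by blast
  next
    assume a0: "a \<noteq> 0"
    \<comment> \<open>As \<omega>' = a, the derivative of ln \<omega> is a/\<omega>; the division by
      a in the formula compensates this factor.\<close>
    have "((\<lambda>u. cot \<theta>\<^sub>0 / a * ln (\<omega> u)) has_real_derivative cot \<theta>\<^sub>0 / \<omega> u) (at u)" if u: "u \<in> I" for u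
      using DERIV_cmult[OF DERIV_chain2[OF DERIV_ln[OF \<omega>pos[OF u]] a[OF u]], of "cot \<theta>\<^sub>0 / a"] a0
      by (simp add: field_simps)
    from graph[OF this]
    show "\<exists>\<sigma>\<in>{1, -1}. \<exists>b. locally_graph \<kappa> K \<alpha> s\<^sub>0 (\<lambda>u. \<sigma> * (cot \<theta>\<^sub>0 / a) * ln (\<omega> u) + b)"
      by (simp only: mult.assoc)
  next
    assume a0: "a = 0"
    have "convex I" using I by (simp add: open_interval_def is_interval_convex)
    then obtain c where c: "\<And>u. u \<in> I \<Longrightarrow> \<omega> u = c"
      using has_field_derivative_zero_constant[of I \<omega>] a a0 by (metis has_field_derivative_at_within)
    \<comment> \<open>With \<omega> equal to the constant c the integrand is constant and its
      antiderivative linear.\<close>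
    have "((\<lambda>u. cot \<theta>\<^sub>0 / c * u) has_real_derivative cot \<theta>\<^sub>0 / \<omega> u) (at u)" if u: "u \<in> I" for u
      using DERIV_cmult[OF DERIV_ident, of "cot \<theta>\<^sub>0 / c" u] c[OF u] by simp
    from graph[OF this]
    have "\<exists>\<sigma>\<in>{1, -1}. \<exists>b. locally_graph \<kappa> K \<alpha> s\<^sub>0 (\<lambda>u. \<sigma> * (cot \<theta>\<^sub>0 / c) * u + b)"
      by (simp only: mult.assoc)
    then show "\<exists>c. (\<forall>u\<in>I. \<omega> u = c) \<and>
        (\<exists>\<sigma>\<in>{1, -1}. \<exists>b. locally_graph \<kappa> K \<alpha> s\<^sub>0 (\<lambda>u. \<sigma> * (cot \<theta>\<^sub>0 / c) * u + b))"
      using c by blast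
  qed
qed

end
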